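(* Let $A=\{\mathbf{a}_1,\ldots,\mathbf{a}_p\}$ and $B=\{\mathbf{b}_1,\ldots,\mathbf{b}_q\}$ be subsets of $\mathbb{N}^n$. Suppose that the elements of $B$ lie on a line, i.e., $q\ge 2$ and there exist $\mathbf{b}\in\mathbb{N}^n$ and $u_1,\ldots,u_q\in\mathbb{N}$ with $\mathbf{b}_j=u_j\mathbf{b}$ for all $j$. Suppose that $\langle A\rangle$ and $\langle B\rangle$ can be glued, and let $\langle C\rangle$ be a gluing of $\langle A\rangle$ and $\langle B\rangle$. Then $\dim k[A]=\dim k[C]$ and $\operatorname{depth}(k[A])=\operatorname{depth}(k[C])$. In particular, $k[C]$ is Cohen-Macaulay if and only if $k[A]$ is Cohen-Macaulay.
   Context: Here $\mathbb{N}=\{0,1,2,\ldots\}$, $n\ge 1$, and $k$ is an arbitrary field. All generators $\mathbf{a}_i,\mathbf{b}_j$ of semigroups are nonzero vectors. For $A=\{\mathbf{a}_1,\ldots,\mathbf{a}_p\}\subset\mathbb{N}^n$, $\langle A\rangle$ is the semigroup of all $\mathbb{N}$-linear combinations of elements of $A$; $I_A$ is the kernel of the $k$-algebra map $k[x_1,\ldots,x_p]\to k[t_1,\ldots,t_n]$, $x_j\mapsto t^{\mathbf{a}_j}=\prod_{i=1}^n t_i^{a_{ij}}$, and $k[A]\simeq k[x_1,\ldots,x_p]/I_A$ is the semigroup ring. Similarly for $B$, with variables $y_1,\ldots,y_q$ and $I_B\subset k[y_1,\ldots,y_q]$. For positive integers $k_1,k_2$ and $C=k_1A\cup k_2B$,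 let $I_C\subset R=k[x_1,\ldots,x_p,y_1,\ldots,y_q]$ be the kernel of the $k$-algebra map $R\to k[t_1,\ldots,t_n]$, $x_i\mapsto t^{k_1\mathbf{a}_i}$, $y_j\mapsto t^{k_2\mathbf{b}_j}$, and $k[C]\simeq R/I_C$. One says that $\langle C\rangle$ is a gluing of $\langle A\rangle$ and $\langle B\rangle$ if $I_C=I_AR+I_BR+\langle\rho\rangle$ for some nonzero binomial $\rho=x_1^{\alpha_1}\cdots x_p^{\alpha_p}-y_1^{\beta_1}\cdots y_q^{\beta_q}$ with $\alpha\in\mathbb{N}^p$, $\beta\in\mathbb{N}^q$. The semigroups $\langle A\rangle$ and $\langle B\rangle$ can be glued if such a gluing exists for some positive integers $k_1,k_2$. $\dim$ is Krull dimension, and depth is taken with respect to the homogeneous maximal ideal (generated by the images of all the variables), the rings being graded by giving each variable the degree of its image in $\mathbb{N}^n$. *)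

theory Defs
  imports
    "HOL-Library.Poly_Mapping"
    "HOL-Library.Extended_Nat"
    "HOL-Analysis.Finite_Cartesian_Product"
    "HOL-Algebra.Algebraic_Closure_Type"
begin

text \<open>The supremum of the lengths of the strict chains of prime ideals
  \<open>P 0 \<subset> P 1 \<subset> \<dots> \<subset> P d\<close>.
  By convention it is \<open>0\<close> for the zero ring.\<close>

definition krull_dim :: "('a, 'm) ring_scheme \<Rightarrow> enat" where
  "krull_dim R = Sup {enat d | d. \<exists>P :: nat \<Rightarrow> 'a set.
     (\<forall>i\<le>d. primeideal (P i) R) \<and> (\<forall>i<d. P i \<subset> P (Suc i))}"

text \<open>The condition on \<open>xs ! i\<close> says that its residue class is a nonzerodivisor in
  \<open>R\<close> modulo the ideal generated by \<open>xs ! 0, \<dots>, xs ! (i - 1)\<close>.\<close>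

definition regular_sequence :: "('a, 'm) ring_scheme \<Rightarrow> 'a list \<Rightarrow> bool" where
  "regular_sequence R xs \<longleftrightarrow>
     set xs \<subseteq> carrier R \<and>
     (\<forall>i<length xs. \<forall>r\<in>carrier R.
        xs ! i \<otimes>\<^bsub>R\<^esub> r \<in> Idl\<^bsub>R\<^esub> (set (take i xs)) \<longrightarrow> r \<in> Idl\<^bsub>R\<^esub> (set (take i xs))) \<and>
     Idl\<^bsub>R\<^esub> (set xs) \<noteq> carrier R"

definition depth :: "('a, 'm) ring_scheme \<Rightarrow> 'a set \<Rightarrow> enat" where
  "depth R m = Sup {enat (length xs) | xs. set xs \<subseteq> m \<and> regular_sequence R xs}"

text \<open>The notion for graded rings: \<open>m\<close> is the homogeneous maximal ideal of \<open>R\<close>.\<close>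

definition cohen_macaulay :: "('a, 'm) ring_scheme \<Rightarrow> 'a set \<Rightarrow> bool" where
  "cohen_macaulay R m \<longleftrightarrow> depth R m = krull_dim R"

type_synonym ('v, 'k) mpoly = "('v \<Rightarrow>\<^sub>0 nat) \<Rightarrow>\<^sub>0 'k"

abbreviation mpoly_ring :: "('v, 'k::field) mpoly ring" where
  "mpoly_ring \<equiv> ring_of_type_algebra"

definition Var :: "'v \<Rightarrow> ('v, 'k::field) mpoly" where
  "Var v = Poly_Mapping.single (Poly_Mapping.single v 1) 1"

definition Const :: "'k \<Rightarrow> ('v, 'k::field) mpoly" where
  "Const c = Poly_Mapping.single 0 c"

text \<open>The \<open>k\<close>-algebra map sending the variable \<open>v\<close> to \<open>\<phi> v\<close>.\<close>

definition mpoly_subst ::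
    "('v::finite \<Rightarrow> ('w, 'k::field) mpoly) \<Rightarrow> ('v, 'k) mpoly \<Rightarrow> ('w, 'k) mpoly" where
  "mpoly_subst \<phi> f = (\<Sum>m\<in>Poly_Mapping.keys f.
     Const (Poly_Mapping.lookup f m) * (\<Prod>v\<in>UNIV. \<phi> v ^ Poly_Mapping.lookup m v))"

text \<open>A generating set \<open>{a\<^sub>1, \<dots>, a\<^sub>p}\<close> of a subsemigroup of \<open>\<nat>\<^sup>n\<close> is given by a
  family \<open>a :: 'p \<Rightarrow> nat ^ 'n\<close>, where \<open>p = CARD('p)\<close>; the index type \<open>'p\<close> also serves as
  the set of variables of \<open>k[x\<^sub>1, \<dots>, x\<^sub>p]\<close>.\<close>

definition t_power :: "nat ^ 'n::finite \<Rightarrow> ('n, 'k::field) mpoly" where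
  "t_power s = (\<Prod>i\<in>UNIV. Var i ^ (s $ i))"

definition toric_ideal :: "('v::finite \<Rightarrow> nat ^ 'n::finite) \<Rightarrow> ('v, 'k::field) mpoly set" where
  "toric_ideal a =
     a_kernel mpoly_ring (mpoly_ring :: ('n, 'k) mpoly ring) (mpoly_subst (\<lambda>v. t_power (a v)))"

definition semigroup_ring ::
    "'k::field itself \<Rightarrow> ('v::finite \<Rightarrow> nat ^ 'n::finite) \<Rightarrow> ('v, 'k) mpoly set ring" where
  "semigroup_ring _ a = mpoly_ring Quot toric_ideal a"

definition homogeneous_maximal_ideal ::
    "'k::field itself \<Rightarrow> ('v::finite \<Rightarrow> nat ^ 'n::finite) \<Rightarrow> ('v, 'k) mpoly set set" where
  "homogeneous_maximal_ideal K a =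
     Idl\<^bsub>semigroup_ring K a\<^esub> (range (\<lambda>v. toric_ideal a +>\<^bsub>mpoly_ring\<^esub> Var v))"

text \<open>The generating family of \<open>C = k\<^sub>1 A \<union> k\<^sub>2 B\<close>; the variables \<open>x\<^sub>i\<close> and \<open>y\<^sub>j\<close> of
  \<open>R = k[x\<^sub>1, \<dots>, x\<^sub>p, y\<^sub>1, \<dots>, y\<^sub>q]\<close> are \<open>Var (Inl i)\<close> and \<open>Var (Inr j)\<close>.\<close>

definition glued_family ::
    "nat \<Rightarrow> nat \<Rightarrow> ('p \<Rightarrow> nat ^ 'n::finite) \<Rightarrow> ('q \<Rightarrow> nat ^ 'n) \<Rightarrow> 'p + 'q \<Rightarrow> nat ^ 'n" where
  "glued_family k1 k2 a b = case_sum (\<lambda>i. k1 *s a i) (\<lambda>j. k2 *s b j)"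

definition gluing_binomial ::
    "nat ^ 'p::finite \<Rightarrow> nat ^ 'q::finite \<Rightarrow> ('p + 'q, 'k::field) mpoly" where
  "gluing_binomial \<alpha> \<beta> =
     (\<Prod>i\<in>UNIV. Var (Inl i) ^ (\<alpha> $ i)) - (\<Prod>j\<in>UNIV. Var (Inr j) ^ (\<beta> $ j))"

definition is_gluing ::
    "'k::field itself \<Rightarrow> nat \<Rightarrow> nat \<Rightarrow>
     ('p::finite \<Rightarrow> nat ^ 'n::finite) \<Rightarrow> ('q::finite \<Rightarrow> nat ^ 'n) \<Rightarrow> bool" where
  "is_gluing _ k1 k2 a b \<longleftrightarrow> 0 < k1 \<and> 0 < k2 \<and>
     (\<exists>\<alpha> \<beta>. let R = (mpoly_ring :: ('p + 'q, 'k) mpoly ring); \<rho> = gluing_binomial \<alpha> \<beta> in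
        \<rho> \<noteq> 0 \<and>
        toric_ideal (glued_family k1 k2 a b) =
          Idl\<^bsub>R\<^esub> (mpoly_subst (\<lambda>i. Var (Inl i)) ` toric_ideal a) <+>\<^bsub>R\<^esub>
          Idl\<^bsub>R\<^esub> (mpoly_subst (\<lambda>j. Var (Inr j)) ` toric_ideal b) <+>\<^bsub>R\<^esub>
          Idl\<^bsub>R\<^esub> {\<rho>})"

definition can_be_glued ::
    "'k::field itself \<Rightarrow>
     ('p::finite \<Rightarrow> nat ^ 'n::finite) \<Rightarrow> ('q::finite \<Rightarrow> nat ^ 'n) \<Rightarrow> bool" where
  "can_be_glued K a b \<longleftrightarrow> (\<exists>k1 k2. is_gluing K k1 k2 a b)"

definition on_a_line :: "('q::finite \<Rightarrow> nat ^ 'n::finite) \<Rightarrow> bool" where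
  "on_a_line b \<longleftrightarrow> CARD('q) \<ge> 2 \<and> (\<exists>v u. \<forall>j. b j = u j *s v)"

end

(*
  The relation k1 (alpha . a) = k2 w v coming from the gluing binomial makes every element of <C>
  uniquely of the form k1 s + k2 d v, where s lies in <A> and d in the Apery set, with respect to w, of
  the numerical semigroup generated by the u_j. Existence is division with remainder by w; uniqueness is
  where the ideal equation is used: the ideal I_A R + I_B R + <rho> is contained in the ideal spanned by
  the differences of monomials that agree in Z^n x Z modulo (alpha . a, -w). Hence k[C] is a finite free
  k[A]-module and an integral extension, so dimensions agree by going up and incomparability.
  A regular sequence on k[A] stays regular on k[C]. If it is maximal, then its maximal ideal kills a
  nonzero class; since powers of the variables y_j lie in m_A k[C], so does the maximal ideal of k[C]
  after extension. As maximal regular sequences have equal length, the depths agree.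
*)
theory Submission
  imports Defs
begin

section \<open>Ideals and Noetherian modules over subrings\<close>

text \<open>Two obstacles shape the development. First, k[A] and k[C] are quotients of different
  polynomial rings. Replacing A by k_1 A, which has the same toric ideal, makes both of them
  subrings of k[t_1,...,t_n], where ideals, regular sequences and quotients are handled as subsets
  of one type. Second, depth ranges over arbitrary elements of the ideal of the variables in a ring
  that is not local, so regular sequences cannot be permuted freely. Maximality of a sequence is
  therefore expressed by a nonzero class killed by the whole ideal, and equality of lengths comes
  from an exchange argument, an elementary substitute for Ext. The ideal equation is used in both
  directions: the membership of \<rho> in I_C gives the degree relation, and the other inclusion
  rules out further coincidences of degrees. As Z^n x Z modulo (\<gamma>, -w) may have torsion, a
  residue modulo w has to accompany the linear invariant w * degA + degB * \<gamma>.\<close>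

locale comm_subring =
  fixes S :: "'a::comm_ring_1 set"
  assumes one_mem: "1 \<in> S"
    and diff_mem: "\<And>x y. x \<in> S \<Longrightarrow> y \<in> S \<Longrightarrow> x - y \<in> S"
    and mult_mem: "\<And>x y. x \<in> S \<Longrightarrow> y \<in> S \<Longrightarrow> x * y \<in> S"
begin

lemma zero_mem: "0 \<in> S"
  using diff_mem[OF one_mem one_mem] by simp

lemma uminus_mem: "x \<in> S \<Longrightarrow> - x \<in> S"
  using diff_mem[OF zero_mem] by force

lemma add_mem: "x \<in> S \<Longrightarrow> y \<in> S \<Longrightarrow> x + y \<in> S"
  using diff_mem[of x "- y"] uminus_mem by simp

lemma power_mem: "x \<in> S \<Longrightarrow> x ^ n \<in> S"
  by (induction n) (auto intro: one_mem mult_mem)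

lemma prod_mem: "(\<And>i. i \<in> I \<Longrightarrow> f i \<in> S) \<Longrightarrow> prod f I \<in> S"
  by (induction I rule: infinite_finite_induct) (auto intro: one_mem mult_mem)

lemma sum_mem: "(\<And>i. i \<in> I \<Longrightarrow> f i \<in> S) \<Longrightarrow> sum f I \<in> S"
  by (induction I rule: infinite_finite_induct) (auto intro: zero_mem add_mem)

end

text \<open>The scalars are kept apart from the ambient ring. This covers ideals of
  \<open>S\<close>, ideals of an extension viewed over a smaller ring and, for empty
  \<open>S\<close>, sets closed under finite sums.\<close>

definition submod :: "'a::comm_ring_1 set \<Rightarrow> 'a set \<Rightarrow> bool" where
  "submod S N \<longleftrightarrow> 0 \<in> N \<and> (\<forall>x\<in>N. \<forall>y\<in>N. x + y \<in> N) \<and> (\<forall>s\<in>S. \<forall>x\<in>N. s * x \<in> N)"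

definition gen :: "'a::comm_ring_1 set \<Rightarrow> 'a set \<Rightarrow> 'a set" where
  "gen S B = \<Inter>{N. submod S N \<and> B \<subseteq> N}"

lemma submodI:
  "0 \<in> N \<Longrightarrow> (\<And>x y. x \<in> N \<Longrightarrow> y \<in> N \<Longrightarrow> x + y \<in> N) \<Longrightarrow>
    (\<And>s x. s \<in> S \<Longrightarrow> x \<in> N \<Longrightarrow> s * x \<in> N) \<Longrightarrow> submod S N"
  by (auto simp: submod_def)

lemma submod_zero: "submod S N \<Longrightarrow> 0 \<in> N"
  and submod_add: "submod S N \<Longrightarrow> x \<in> N \<Longrightarrow> y \<in> N \<Longrightarrow> x + y \<in> N"
  and submod_mult: "submod S N \<Longrightarrow> s \<in> S \<Longrightarrow> x \<in> N \<Longrightarrow> s * x \<in> N"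
  by (auto simp: submod_def)

lemma submod_sum: "submod S N \<Longrightarrow> (\<And>i. i \<in> I \<Longrightarrow> f i \<in> N) \<Longrightarrow> sum f I \<in> N"
  by (induction I rule: infinite_finite_induct) (auto simp: submod_def)

lemma submod_Int: "submod S M \<Longrightarrow> submod S N \<Longrightarrow> submod S (M \<inter> N)"
  by (auto simp: submod_def)

lemma submod_zero_set: "submod S {0}"
  by (auto simp: submod_def)

lemma submod_restrict: "submod S N \<Longrightarrow> T \<subseteq> S \<Longrightarrow> submod T N"
  by (auto simp: submod_def)

lemma submod_Union_chain:
  assumes "C \<noteq> {}" "\<And>N. N \<in> C \<Longrightarrow> submod S N" "\<And>M N. M \<in> C \<Longrightarrow> N \<in> C \<Longrightarrow> M \<subseteq> N \<or> N \<subseteq> M"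
  shows "submod S (\<Union>C)"
proof (rule submodI)
  show "0 \<in> \<Union>C" using assms(1,2) submod_zero by blast
  fix x y assume "x \<in> \<Union>C" "y \<in> \<Union>C"
  then obtain M N where "x \<in> M" "y \<in> N" "M \<in> C" "N \<in> C" by blast
  with assms(3)[of M N] have "\<exists>K\<in>C. x \<in> K \<and> y \<in> K" by blast
  with assms(2) show "x + y \<in> \<Union>C" using submod_add by blast
qed (use assms(2) submod_mult in blast)

lemma gen_least: "submod S N \<Longrightarrow> B \<subseteq> N \<Longrightarrow> gen S B \<subseteq> N"
  by (auto simp: gen_def)

lemma submod_gen: "submod S (gen S B)"
  by (auto simp: gen_def submod_def)

lemma gen_base: "x \<in> B \<Longrightarrow> x \<in> gen S B"
  by (auto simp: gen_def)

lemma gen_zero: "0 \<in> gen S B"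
  by (rule submod_zero[OF submod_gen])

lemma gen_step: "s \<in> S \<Longrightarrow> x \<in> B \<Longrightarrow> y \<in> gen S B \<Longrightarrow> s * x + y \<in> gen S B"
  by (rule submod_add[OF submod_gen submod_mult[OF submod_gen _ gen_base]])

context comm_subring
begin

lemma submod_self: "submod S S"
  by (auto simp: submod_def zero_mem add_mem mult_mem)

lemma submod_uminus: "submod S N \<Longrightarrow> x \<in> N \<Longrightarrow> - x \<in> N"
  using submod_mult[of S N "-1" x] uminus_mem[OF one_mem] by simp

lemma submod_diff: "submod S N \<Longrightarrow> x \<in> N \<Longrightarrow> y \<in> N \<Longrightarrow> x - y \<in> N"
  using submod_add[of S N x "- y"] submod_uminus by simp

text \<open>The predicate is strengthened to "adding a multiple of this element preserves
  \<open>P\<close>", which is closed under sums although \<open>P\<close> itself need not be. Thus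
  the step only has to add one multiple of a generator.\<close>

lemma gen_induct [consumes 1, case_names zero step]:
  assumes "y \<in> gen S B"
    and zero: "P 0"
    and step: "\<And>s x y. s \<in> S \<Longrightarrow> x \<in> B \<Longrightarrow> y \<in> gen S B \<Longrightarrow> P y \<Longrightarrow> P (s * x + y)"
  shows "P y"
proof -
  define N where "N = {y \<in> gen S B. \<forall>s\<in>S. \<forall>z\<in>gen S B. P z \<longrightarrow> P (s * y + z)}"
  have "submod S N"
  proof (rule submodI)
    show "0 \<in> N" by (auto simp: N_def gen_zero)
  next
    fix x y assume xy: "x \<in> N" "y \<in> N"
    have "P (s * (x + y) + z)" if "s \<in> S" "z \<in> gen S B" "P z" for s z
    proof -
      have "s * y + z \<in> gen S B"
        using xy that by (intro submod_add[OF submod_gen] submod_mult[OF submod_gen]) (auto simp: N_def)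
      then have "P (s * x + (s * y + z))"
        using xy that by (auto simp: N_def)
      then show ?thesis by (simp add: algebra_simps)
    qed
    with xy show "x + y \<in> N" using submod_add[OF submod_gen] by (auto simp: N_def)
  next
    fix t y assume "t \<in> S" "y \<in> N"
    then show "t * y \<in> N"
      using submod_mult[OF submod_gen] mult_mem by (auto simp: N_def simp flip: mult.assoc)
  qed
  moreover have "B \<subseteq> N" by (auto simp: N_def gen_base step)
  ultimately have "y \<in> N" using gen_least assms(1) by blast
  then have "P (1 * y + 0)" using one_mem zero gen_zero[of S B] unfolding N_def by blast
  then show ?thesis by simp
qed

lemma gen_subset: "B \<subseteq> gen S Y \<Longrightarrow> gen S B \<subseteq> gen S Y"
  by (rule gen_least[OF submod_gen])

lemma gen_mono: "B \<subseteq> Y \<Longrightarrow> gen S B \<subseteq> gen S Y"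
  by (rule gen_subset) (auto intro: gen_base)

lemma gen_in: "B \<subseteq> S \<Longrightarrow> gen S B \<subseteq> S"
  by (rule gen_least[OF submod_self])

lemma gen_submod: "submod S N \<Longrightarrow> gen S N = N"
  using gen_least[of S N N] gen_base by blast

lemma gen_empty: "gen S {} = {0}"
  using gen_least[OF submod_zero_set, of "{}" S] gen_zero by blast

lemma submod_ext: "submod S M \<Longrightarrow> submod S {s * e + m | s m. s \<in> S \<and> m \<in> M}"
proof (rule submodI, goal_cases)
  case 1 then show ?case
    by (intro CollectI exI[of _ 0]) (auto intro: submod_zero zero_mem)
next
  case (2 x y)
  then obtain s m t n where "s \<in> S" "m \<in> M" "x = s * e + m" "t \<in> S" "n \<in> M" "y = t * e + n"
    by blast
  with 2 show ?case
    by (intro CollectI exI[of _ "s + t"] exI[of _ "m + n"])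
      (auto simp: algebra_simps add_mem submod_add)
next
  case (3 t x)
  then obtain s m where *: "s \<in> S" "m \<in> M" "x = s * e + m"
    by blast
  have "t * x = (t * s) * e + t * m" using * by (simp add: algebra_simps)
  with 3 * show ?case using mult_mem submod_mult by blast
qed

lemma gen_insert_eq: "gen S (insert x B) = {s * x + y | s y. s \<in> S \<and> y \<in> gen S B}" (is "_ = ?R")
proof
  have "insert x B \<subseteq> ?R"
  proof
    fix y assume "y \<in> insert x B"
    then consider "y = x" | "y \<in> B" by auto
    then show "y \<in> ?R"
    proof cases
      case 1 then show ?thesis by (intro CollectI exI[of _ 1] exI[of _ 0]) (auto simp: one_mem gen_zero)
    next
      case 2 then show ?thesis by (intro CollectI exI[of _ 0] exI[of _ y]) (auto simp: zero_mem gen_base)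
    qed
  qed
  then show "gen S (insert x B) \<subseteq> ?R" by (intro gen_least submod_ext submod_gen)
  show "?R \<subseteq> gen S (insert x B)"
    using gen_mono[of B "insert x B"] gen_step[of _ S x "insert x B"] by blast
qed

lemma gen_insertE:
  assumes "y \<in> gen S (insert x B)"
  obtains s z where "s \<in> S" "z \<in> gen S B" "y = s * x + z"
  using assms unfolding gen_insert_eq by blast

lemma gen_finitary:
  assumes "y \<in> gen S B"
  obtains F where "finite F" "F \<subseteq> B" "y \<in> gen S F"
proof -
  from assms have "\<exists>F. finite F \<and> F \<subseteq> B \<and> y \<in> gen S F"
  proof (induction rule: gen_induct)
    case zero
    show ?case by (intro exI[of _ "{}"]) (auto intro: gen_zero)
  next
    case (step s x y)
    then obtain F where F: "finite F" "F \<subseteq> B" "y \<in> gen S F" by blast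
    with step have "s * x + y \<in> gen S (insert x F)" unfolding gen_insert_eq by blast
    with F step show ?case by (intro exI[of _ "insert x F"]) auto
  qed
  with that show ?thesis by blast
qed

end

section \<open>Noetherian modules: extensions, finite generation and maximal submodules\<close>

definition noetherian_over :: "'a::comm_ring_1 set \<Rightarrow> 'a set \<Rightarrow> bool" where
  "noetherian_over S M \<longleftrightarrow>
    (\<forall>N. submod S N \<longrightarrow> N \<subseteq> M \<longrightarrow> (\<exists>F. finite F \<and> F \<subseteq> N \<and> N = gen S F))"

lemma noetherian_overE:
  assumes "noetherian_over S M" "submod S N" "N \<subseteq> M"
  obtains F where "finite F" "F \<subseteq> N" "N = gen S F"
  using assms unfolding noetherian_over_def by blast

context comm_subring
begin

text \<open>A submodule of S e + M is controlled by its ideal of coefficients at e and by its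
  intersection with \<open>M\<close>. The expression s e + m need not be unique, so \<open>I\<close>
  collects every coefficient that occurs in some expression.\<close>

lemma noetherian_over_ext:
  assumes S: "noetherian_over S S" and M: "submod S M" "noetherian_over S M"
  shows "noetherian_over S {s * e + m | s m. s \<in> S \<and> m \<in> M}"
  unfolding noetherian_over_def
proof (intro allI impI)
  fix N assume N: "submod S N" "N \<subseteq> {s * e + m | s m. s \<in> S \<and> m \<in> M}"
  define I where "I = {s \<in> S. \<exists>m\<in>M. s * e + m \<in> N}"
  have "submod S I"
  proof (rule submodI)
    show "0 \<in> I" using submod_zero[OF N(1)] submod_zero[OF M(1)] zero_mem by (auto simp: I_def)
  next
    fix s t assume "s \<in> I" "t \<in> I"
    then obtain m n where mn: "s \<in> S" "t \<in> S" "m \<in> M" "n \<in> M" "s * e + m \<in> N" "t * e + n \<in> N"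
      by (auto simp: I_def)
    then have "(s + t) * e + (m + n) \<in> N" using submod_add[OF N(1) mn(5,6)] by (simp add: algebra_simps)
    with mn show "s + t \<in> I" using submod_add[OF M(1)] add_mem by (auto simp: I_def)
  next
    fix t s assume t: "t \<in> S" and "s \<in> I"
    then obtain m where m: "s \<in> S" "m \<in> M" "s * e + m \<in> N"
      by (auto simp: I_def)
    then have "(t * s) * e + (t * m) \<in> N" using submod_mult[OF N(1) t m(3)] by (simp add: algebra_simps)
    with m t show "t * s \<in> I" using submod_mult[OF M(1)] mult_mem by (auto simp: I_def)
  qed
  then obtain F where F: "finite F" "F \<subseteq> I" "I = gen S F"
    using noetherian_overE[OF S] I_def by blast
  then have "\<forall>s\<in>F. \<exists>m\<in>M. s * e + m \<in> N" by (auto simp: I_def)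
  then obtain h where h: "\<And>s. s \<in> F \<Longrightarrow> h s \<in> M" "\<And>s. s \<in> F \<Longrightarrow> s * e + h s \<in> N" by metis
  obtain G where G: "finite G" "G \<subseteq> N \<inter> M" "N \<inter> M = gen S G"
    using noetherian_overE[OF M(2) submod_Int[OF N(1) M(1)]] by blast
  let ?H = "(\<lambda>s. s * e + h s) ` F \<union> G"
  \<comment> \<open>Each coefficient in \<open>I\<close> is realised by an element of
    \<open>gen S ?H\<close> up to an error in \<open>M\<close>; subtracting that element moves a
    member of \<open>N\<close> into N \<inter> M.\<close>
  have lift: "\<exists>y\<in>gen S ?H. y - s * e \<in> M" if "s \<in> gen S F" for s
    using that
  proof (induction rule: gen_induct)
    case zero
    show ?case by (rule bexI[of _ 0]) (auto simp: submod_zero[OF M(1)] gen_zero)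
  next
    case (step s x y)
    then obtain z where z: "z \<in> gen S ?H" "z - y * e \<in> M" by blast
    have H: "s * (x * e + h x) + z \<in> gen S ?H" using step z by (intro gen_step) auto
    have eq: "s * (x * e + h x) + z - (s * x + y) * e = s * h x + (z - y * e)"
      by (simp add: algebra_simps)
    have "s * h x + (z - y * e) \<in> M"
      using submod_add[OF M(1) submod_mult[OF M(1)]] h z step by blast
    then have "s * (x * e + h x) + z - (s * x + y) * e \<in> M" unfolding eq .
    with H show ?case by blast
  qed
  have HN: "?H \<subseteq> N" using h G by auto
  have "N \<subseteq> gen S ?H"
  proof
    fix y assume y: "y \<in> N"
    then obtain s m where sm: "y = s * e + m" "s \<in> S" "m \<in> M" using N by blast
    with y have "s \<in> gen S F" using F(3) by (auto simp: I_def)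
    then obtain z where z: "z \<in> gen S ?H" "z - s * e \<in> M" using lift by blast
    have eq: "y - z = m - (z - s * e)" using sm by (simp add: algebra_simps)
    have "y - z \<in> M" unfolding eq by (rule submod_diff[OF M(1) sm(3) z(2)])
    moreover have "y - z \<in> N" using submod_diff[OF N(1) y] gen_least[OF N(1) HN] z by blast
    ultimately have "y - z \<in> gen S ?H" using G gen_mono[of G ?H] by blast
    then show "y \<in> gen S ?H" using submod_add[OF submod_gen z(1)] by fastforce
  qed
  then show "\<exists>F. finite F \<and> F \<subseteq> N \<and> N = gen S F"
    using HN gen_least[OF N(1) HN] F(1) G(1) by (intro exI[of _ ?H]) auto
qed

lemma noetherian_over_gen:
  assumes S: "noetherian_over S S" and "finite B"
  shows "noetherian_over S (gen S B)"
  using assms(2)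
proof induction
  case empty
  show ?case unfolding gen_empty noetherian_over_def
    by (intro allI impI exI[of _ "{}"]) (auto simp: gen_empty dest: submod_zero)
next
  case (insert x B)
  then show ?case unfolding gen_insert_eq by (intro noetherian_over_ext S submod_gen)
qed

text \<open>Each of the finitely many generators of the span involves finitely many elements of
  \<open>Z\<close>, so generators can be chosen inside \<open>Z\<close>. Integral equations and the
  finiteness of the set of maximal colon ideals depend on this choice.\<close>

lemma noetherian_over_finite_subset:
  assumes "noetherian_over S M" "submod S M" "Z \<subseteq> M"
  obtains F where "finite F" "F \<subseteq> Z" "gen S Z = gen S F"
proof -
  obtain G where G: "finite G" "G \<subseteq> gen S Z" "gen S Z = gen S G"
    using noetherian_overE[OF assms(1) submod_gen gen_least[OF assms(2,3)]] by blast
  have "\<exists>F. finite F \<and> F \<subseteq> Z \<and> G \<subseteq> gen S F"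
    using G(1,2)
  proof induction
    case (insert g G)
    then obtain F where F: "finite F" "F \<subseteq> Z" "G \<subseteq> gen S F" by auto
    obtain F' where F': "finite F'" "F' \<subseteq> Z" "g \<in> gen S F'" using gen_finitary insert by blast
    show ?case using F F' gen_mono[of F "F \<union> F'"] gen_mono[of F' "F \<union> F'"]
      by (intro exI[of _ "F \<union> F'"]) auto
  qed auto
  then obtain F where F: "finite F" "F \<subseteq> Z" "G \<subseteq> gen S F" by blast
  then have "gen S Z = gen S F" using gen_mono[of F Z] gen_subset[of G F] G by blast
  with F that show ?thesis by blast
qed

text \<open>Zorn's lemma applies because the union of a chain is finitely generated: its generators
  lie in one member, which is then the whole union.\<close>

lemma noetherian_maximal:
  assumes "noetherian_over S M" "\<F> \<noteq> {}"
    and \<F>: "\<And>N. N \<in> \<F> \<Longrightarrow> submod S N \<and> N \<subseteq> M"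
  obtains N where "N \<in> \<F>" "\<And>N'. N' \<in> \<F> \<Longrightarrow> N \<subseteq> N' \<Longrightarrow> N' = N"
proof -
  have "\<exists>N\<in>\<F>. \<forall>B\<in>\<F>. N \<subseteq> B \<longrightarrow> B = N"
  proof (rule subset_Zorn_nonempty[OF assms(2)])
    fix C assume C: "C \<noteq> {}" "subset.chain \<F> C"
    have C\<F>: "C \<subseteq> \<F>" and chain: "\<And>M N. M \<in> C \<Longrightarrow> N \<in> C \<Longrightarrow> M \<subseteq> N \<or> N \<subseteq> M"
      using C(2) by (auto simp: subset_chain_def)
    have "submod S (\<Union>C)"
      using C(1) C\<F> \<F> chain by (intro submod_Union_chain) blast+
    moreover have "\<Union>C \<subseteq> M" using C\<F> \<F> by blast
    ultimately obtain F where F: "finite F" "F \<subseteq> \<Union>C" "\<Union>C = gen S F"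
      by (rule noetherian_overE[OF assms(1)])
    then obtain N where N: "N \<in> C" "F \<subseteq> N"
      using finite_subset_Union_chain[OF F(1,2) C] by blast
    have "N \<in> \<F>" using N C(2) by (auto simp: subset_chain_def)
    then have "gen S F \<subseteq> N" using gen_least N \<F> by blast
    then have "\<Union>C = N" using F(3) N(1) by blast
    with \<open>N \<in> \<F>\<close> show "\<Union>C \<in> \<F>" by simp
  qed
  with that show ?thesis by blast
qed

lemma noetherian_maximal_above:
  assumes "noetherian_over S M" "N0 \<in> \<F>"
    and \<F>: "\<And>N. N \<in> \<F> \<Longrightarrow> submod S N \<and> N \<subseteq> M"
  obtains N where "N \<in> \<F>" "N0 \<subseteq> N" "\<And>N'. N' \<in> \<F> \<Longrightarrow> N \<subseteq> N' \<Longrightarrow> N' = N"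
proof (rule noetherian_maximal[OF assms(1), of "{N \<in> \<F>. N0 \<subseteq> N}"])
  show "{N \<in> \<F>. N0 \<subseteq> N} \<noteq> {}" using assms(2) by blast
  fix N assume N: "N \<in> {N \<in> \<F>. N0 \<subseteq> N}"
    "\<And>N'. N' \<in> {N \<in> \<F>. N0 \<subseteq> N} \<Longrightarrow> N \<subseteq> N' \<Longrightarrow> N' = N"
  show thesis
    by (rule that[of N]) (use N in blast)+
qed (use \<F> in blast)

end

section \<open>Hilbert's basis theorem for a ring S[x] with arbitrary x\<close>

definition adjoin :: "'a::comm_ring_1 set \<Rightarrow> 'a \<Rightarrow> 'a set" where
  "adjoin S x = gen S (range (\<lambda>i. x ^ i))"

context comm_subring
begin

lemma comm_subring_adjoin: "comm_subring (adjoin S x)"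
proof
  show "1 \<in> adjoin S x" unfolding adjoin_def
    by (rule gen_base) (auto intro: image_eqI[of _ _ 0])
  fix y z assume yz: "y \<in> adjoin S x" "z \<in> adjoin S x"
  then show "y - z \<in> adjoin S x" unfolding adjoin_def using submod_diff[OF submod_gen] by blast
  have *: "x ^ i * z \<in> adjoin S x" for i
    using yz(2) unfolding adjoin_def
  proof (induction rule: gen_induct)
    case zero then show ?case by (auto intro: gen_zero)
  next
    case (step s u y)
    then obtain j where j: "u = x ^ j" by blast
    have "s * x ^ (i + j) + x ^ i * y \<in> gen S (range (\<lambda>i. x ^ i))"
      using step by (intro gen_step) auto
    then show ?case by (simp add: j algebra_simps power_add)
  qed
  show "y * z \<in> adjoin S x"
    using yz(1) unfolding adjoin_def
  proof (induction rule: gen_induct)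
    case zero then show ?case by (auto intro: gen_zero)
  next
    case (step s u y)
    then have "u * z \<in> adjoin S x" using * by blast
    then have "s * (u * z) + y * z \<in> adjoin S x" unfolding adjoin_def
      using step submod_add[OF submod_gen submod_mult[OF submod_gen]] unfolding adjoin_def by blast
    then show ?case unfolding adjoin_def by (simp add: algebra_simps)
  qed
qed

lemma adjoin_superset: "S \<subseteq> adjoin S x"
proof
  fix s assume s: "s \<in> S"
  have "x ^ 0 \<in> range (\<lambda>i. x ^ i)" by blast
  from gen_step[OF s this gen_zero] show "s \<in> adjoin S x" by (simp add: adjoin_def)
qed

lemma adjoin_mem: "x \<in> adjoin S x"
  unfolding adjoin_def by (rule gen_base) (auto intro: image_eqI[of _ _ 1])

lemma adjoin_least: "comm_subring T \<Longrightarrow> S \<subseteq> T \<Longrightarrow> x \<in> T \<Longrightarrow> adjoin S x \<subseteq> T"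
  unfolding adjoin_def
  by (intro gen_least submod_restrict[OF comm_subring.submod_self])
    (auto intro: comm_subring.power_mem)

text \<open>Hilbert's argument with leading coefficients. Since \<open>x\<close> may be algebraic
  over \<open>S\<close>, the degree is replaced by the filtration by spans of the powers of
  \<open>x\<close> below d.\<close>

lemma noetherian_adjoin:
  assumes S: "noetherian_over S S"
  shows "noetherian_over (adjoin S x) (adjoin S x)"
  unfolding noetherian_over_def
proof (intro allI impI)
  interpret T: comm_subring "adjoin S x" by (rule comm_subring_adjoin)
  fix I assume I: "submod (adjoin S x) I" "I \<subseteq> adjoin S x"
  have IS: "submod S I" using submod_restrict[OF I(1) adjoin_superset] .
  define low where "low d = gen S ((\<lambda>i. x ^ i) ` {..<d})" for d :: nat
  have low_submod: "submod S (low d)" for d unfolding low_def by (rule submod_gen)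
  have low_Suc: "low (Suc d) = {s * x ^ d + m | s m. s \<in> S \<and> m \<in> low d}" for d
    unfolding low_def lessThan_Suc image_insert gen_insert_eq ..
  have low_mono: "low d \<subseteq> low e" if "d \<le> e" for d e
    unfolding low_def using that by (intro gen_mono image_mono) auto
  have low_shift: "x ^ e * m \<in> low (d + e)" if "m \<in> low d" for m d e
    using that unfolding low_def
  proof (induction rule: gen_induct)
    case zero then show ?case by (auto intro: gen_zero)
  next
    case (step s u y)
    then obtain j where j: "u = x ^ j" "j < d" by blast
    have "s * x ^ (j + e) + x ^ e * y \<in> gen S ((\<lambda>i. x ^ i) ` {..<d + e})"
      using step j by (intro gen_step) auto
    then show ?case by (simp add: j algebra_simps power_add)
  qed
  have low_noeth: "noetherian_over S (low d)" for d
    unfolding low_def by (intro noetherian_over_gen S) auto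
  have low_exhaust: "\<exists>d. y \<in> low d" if "y \<in> adjoin S x" for y
  proof -
    obtain F where F: "finite F" "F \<subseteq> range (\<lambda>i. x ^ i)" "y \<in> gen S F"
      using gen_finitary \<open>y \<in> adjoin S x\<close> unfolding adjoin_def by blast
    then obtain J where J: "finite J" "F = (\<lambda>i. x ^ i) ` J"
      using finite_subset_image[of F "\<lambda>i. x ^ i" UNIV] by blast
    then obtain d where "J \<subseteq> {..<d}" using finite_nat_iff_bounded by auto
    then have "gen S F \<subseteq> low d" unfolding low_def J by (intro gen_mono image_mono)
    with F show ?thesis by blast
  qed
  \<comment> \<open>The leading coefficient ideals, again over all possible expressions;
    multiplication by \<open>x\<close> makes them increase with d.\<close>
  define L where "L d = {s \<in> S. \<exists>m\<in>low d. s * x ^ d + m \<in> I}" for d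
  have L_submod: "submod S (L d)" for d
  proof (rule submodI)
    show "0 \<in> L d" using submod_zero[OF IS] submod_zero[OF low_submod[of d]] zero_mem
      by (auto simp: L_def)
  next
    fix s t assume "s \<in> L d" "t \<in> L d"
    then obtain m n where mn: "s \<in> S" "t \<in> S" "m \<in> low d" "n \<in> low d"
      "s * x ^ d + m \<in> I" "t * x ^ d + n \<in> I"
      by (auto simp: L_def)
    then have "(s + t) * x ^ d + (m + n) \<in> I"
      using submod_add[OF IS mn(5,6)] by (simp add: algebra_simps)
    with mn show "s + t \<in> L d" using submod_add[OF low_submod] add_mem by (auto simp: L_def)
  next
    fix t s assume t: "t \<in> S" and "s \<in> L d"
    then obtain m where m: "s \<in> S" "m \<in> low d" "s * x ^ d + m \<in> I"
      by (auto simp: L_def)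
    then have "(t * s) * x ^ d + (t * m) \<in> I"
      using submod_mult[OF IS t m(3)] by (simp add: algebra_simps)
    with m t show "t * s \<in> L d" using submod_mult[OF low_submod] mult_mem by (auto simp: L_def)
  qed
  have L_mono: "L d \<subseteq> L e" if "d \<le> e" for d e
  proof
    fix s assume "s \<in> L d"
    then obtain m where m: "s \<in> S" "m \<in> low d" "s * x ^ d + m \<in> I" by (auto simp: L_def)
    have "x ^ (e - d) * (s * x ^ d + m) \<in> I"
      using submod_mult[OF I(1) T.power_mem[OF adjoin_mem] m(3)] .
    moreover have "x ^ (e - d) * (s * x ^ d + m) = s * x ^ e + x ^ (e - d) * m"
      using that by (simp add: algebra_simps flip: power_add)
    moreover have "x ^ (e - d) * m \<in> low e" using low_shift[OF m(2), of "e - d"] that by simp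
    ultimately show "s \<in> L e" using m by (auto simp: L_def)
  qed
  have chain: "L d \<subseteq> L e \<or> L e \<subseteq> L d" for d e using L_mono nat_le_linear by blast
  have "submod S (\<Union>(range L))"
    using L_submod chain by (intro submod_Union_chain) auto
  moreover have "\<Union>(range L) \<subseteq> S" by (auto simp: L_def)
  ultimately obtain F where F: "finite F" "F \<subseteq> \<Union>(range L)" "\<Union>(range L) = gen S F"
    using noetherian_overE[OF S] by metis
  have "subset.chain UNIV (range L)" using chain by (auto simp: subset_chain_def)
  then obtain D where "F \<subseteq> L D"
    using finite_subset_Union_chain[OF F(1,2)] by blast
  \<comment> \<open>From level D on no new leading coefficient appears.\<close>
  then have D: "L d \<subseteq> L D" for d using gen_least[OF L_submod] F(3) by blast
  obtain G where G: "finite G" "G \<subseteq> I \<inter> low (Suc D)" "I \<inter> low (Suc D) = gen S G"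
    using noetherian_overE[OF low_noeth submod_Int[OF IS low_submod[of "Suc D"]]] by blast
  have base: "I \<inter> low (Suc D) \<subseteq> gen (adjoin S x) G"
    unfolding G(3)
    by (intro gen_least submod_restrict[OF submod_gen] adjoin_superset) (auto intro: gen_base)
  have "I \<inter> low d \<subseteq> gen (adjoin S x) G" for d
  proof (induction d)
    case 0
    then show ?case using base low_mono[of 0 "Suc D"] by auto
  next
    case (Suc d)
    show ?case
    proof (cases "d \<le> D")
      case True then show ?thesis using base low_mono[of "Suc d" "Suc D"] by auto
    next
      case False
      show ?thesis
      proof
        fix y assume y: "y \<in> I \<inter> low (Suc d)"
        then obtain s m where sm: "s \<in> S" "m \<in> low d" "y = s * x ^ d + m" unfolding low_Suc by blast
        then have "s \<in> L d" using y by (auto simp: L_def)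
        then have "s \<in> L D" using D by blast
        then obtain m' where m': "m' \<in> low D" "s * x ^ D + m' \<in> I" by (auto simp: L_def)
        \<comment> \<open>This element lies in the ideal generated by \<open>G\<close> and has the
          same leading coefficient as \<open>y\<close> at level d, so y - g drops to
          \<open>low d\<close>.\<close>
        define g where "g = x ^ (d - D) * (s * x ^ D + m')"
        have gI: "g \<in> gen (adjoin S x) G" unfolding g_def
          using base m' sm unfolding low_Suc
          by (intro submod_mult[OF submod_gen] T.power_mem adjoin_mem) blast
        have "y - g = m - x ^ (d - D) * m'" unfolding g_def sm using False
          by (simp add: algebra_simps flip: power_add)
        moreover have "x ^ (d - D) * m' \<in> low d" using low_shift[OF m'(1), of "d - D"] False by simp
        ultimately have "y - g \<in> low d" using submod_diff[OF low_submod sm(2)] by simp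
        moreover have "y - g \<in> I" using y gI gen_least[OF I(1), of G] G(2)
          by (intro submod_diff[OF IS]) auto
        ultimately have "y - g \<in> gen (adjoin S x) G" using Suc by blast
        then show "y \<in> gen (adjoin S x) G" using submod_add[OF submod_gen gI] by fastforce
      qed
    qed
  qed
  then have "I \<subseteq> gen (adjoin S x) G" using low_exhaust I by blast
  then show "\<exists>F. finite F \<and> F \<subseteq> I \<and> I = gen (adjoin S x) F"
    using G gen_least[OF I(1), of G] by (intro exI[of _ G]) auto
qed

text \<open>\<open>T\<close> is characterised by minimality instead of by polynomial expressions;
  this clause later identifies it with a monoid algebra.\<close>

theorem noetherian_finitely_generated:
  assumes "noetherian_over S S" "finite B"
  obtains T where "comm_subring T" "noetherian_over T T" "S \<union> B \<subseteq> T"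
    "\<And>U. comm_subring U \<Longrightarrow> S \<union> B \<subseteq> U \<Longrightarrow> T \<subseteq> U"
proof -
  have "\<exists>T. comm_subring T \<and> noetherian_over T T \<and> S \<union> B \<subseteq> T \<and>
    (\<forall>U. comm_subring U \<longrightarrow> S \<union> B \<subseteq> U \<longrightarrow> T \<subseteq> U)"
    using assms(2)
  proof induction
    case empty
    show ?case using assms(1) comm_subring_axioms by auto
  next
    case (insert x B)
    then obtain T where T: "comm_subring T" "noetherian_over T T" "S \<union> B \<subseteq> T"
      "\<And>U. comm_subring U \<Longrightarrow> S \<union> B \<subseteq> U \<Longrightarrow> T \<subseteq> U" by blast
    interpret T: comm_subring T by fact
    show ?case
    proof (intro exI conjI allI impI)
      show "S \<union> insert x B \<subseteq> adjoin T x" using T(3) T.adjoin_superset T.adjoin_mem by blast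
      fix U assume "comm_subring U" "S \<union> insert x B \<subseteq> U"
      then show "adjoin T x \<subseteq> U" using T(4) T.adjoin_least by simp
    qed (use T.comm_subring_adjoin T.noetherian_adjoin[OF T(2)] in auto)
  qed
  with that show ?thesis by blast
qed

end

section \<open>Maximal regular sequences\<close>

definition prime_in :: "'a::comm_ring_1 set \<Rightarrow> 'a set \<Rightarrow> bool" where
  "prime_in S P \<longleftrightarrow> submod S P \<and> P \<subseteq> S \<and> 1 \<notin> P \<and> (\<forall>x\<in>S. \<forall>y\<in>S. x * y \<in> P \<longrightarrow> x \<in> P \<or> y \<in> P)"

definition annihilator :: "'a::comm_ring_1 set \<Rightarrow> 'a set \<Rightarrow> 'a \<Rightarrow> 'a set" where
  "annihilator S J z = {s \<in> S. s * z \<in> J}"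

definition nzd_mod :: "'a::comm_ring_1 set \<Rightarrow> 'a set \<Rightarrow> 'a \<Rightarrow> bool" where
  "nzd_mod S B x \<longleftrightarrow> (\<forall>r\<in>S. x * r \<in> gen S B \<longrightarrow> r \<in> gen S B)"

text \<open>Quotients are never formed: \<open>B\<close> generates the ideal divided out, and
  passing to the next quotient inserts an element. Properness of the final ideal is supplied by the
  condition \<open>1 \<notin> m\<close> in \<open>depth_ring_on\<close>.\<close>

fun reg_seq :: "'a::comm_ring_1 set \<Rightarrow> 'a set \<Rightarrow> 'a list \<Rightarrow> bool" where
  "reg_seq S B [] \<longleftrightarrow> True"
| "reg_seq S B (x # xs) \<longleftrightarrow> nzd_mod S B x \<and> reg_seq S (insert x B) xs"

text \<open>A nonzero class modulo \<open>B\<close> that is killed by all of \<open>m\<close>. Over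
  a Noetherian ring and for an ideal \<open>m\<close>, this is exactly the obstruction to prolonging
  a regular sequence inside \<open>m\<close>, by \<open>not_has_socle\<close> and
  \<open>common_nonzerodivisor\<close>.\<close>

definition has_socle :: "'a::comm_ring_1 set \<Rightarrow> 'a set \<Rightarrow> 'a set \<Rightarrow> bool" where
  "has_socle S m B \<longleftrightarrow> (\<exists>z\<in>S. z \<notin> gen S B \<and> (\<forall>i\<in>m. i * z \<in> gen S B))"

lemma nzd_modD: "nzd_mod S B x \<Longrightarrow> r \<in> S \<Longrightarrow> x * r \<in> gen S B \<Longrightarrow> r \<in> gen S B"
  by (auto simp: nzd_mod_def)

lemma reg_seq_append: "reg_seq S B (xs @ ys) \<longleftrightarrow> reg_seq S B xs \<and> reg_seq S (B \<union> set xs) ys"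
  by (induction xs arbitrary: B) auto

lemma reg_seq_snoc: "reg_seq S B (xs @ [x]) \<longleftrightarrow> reg_seq S B xs \<and> nzd_mod S (B \<union> set xs) x"
  by (simp add: reg_seq_append)

lemma reg_seq_iff_nth:
  "reg_seq S B xs \<longleftrightarrow> (\<forall>i<length xs. nzd_mod S (B \<union> set (take i xs)) (xs ! i))"
  by (induction xs arbitrary: B) (simp_all add: All_less_Suc2)

lemma not_has_socle: "nzd_mod S B x \<Longrightarrow> x \<in> m \<Longrightarrow> \<not> has_socle S m B"
  by (auto simp: nzd_mod_def has_socle_def)

section \<open>Maximal colon ideals, prime avoidance and the exchange of regular elements\<close>

context comm_subring
begin

lemma submod_annihilator: "submod S J \<Longrightarrow> submod S (annihilator S J z)"
  by (rule submodI)
    (auto simp: annihilator_def zero_mem add_mem mult_mem submod_zero submod_add submod_mult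
      distrib_right mult.assoc)

text \<open>If y z lies outside \<open>J\<close>, its colon ideal contains that of z and so equals
  it by maximality; x y in (J : z) then says that x is in (J : y z) = (J : z).\<close>

lemma maximal_annihilator_prime:
  assumes J: "submod S J" and z: "z \<in> S" "z \<notin> J"
    and max: "\<And>w. w \<in> S \<Longrightarrow> w \<notin> J \<Longrightarrow> annihilator S J z \<subseteq> annihilator S J w \<Longrightarrow>
      annihilator S J w = annihilator S J z"
  shows "prime_in S (annihilator S J z)"
  unfolding prime_in_def
proof (intro conjI ballI impI submod_annihilator J)
  show "annihilator S J z \<subseteq> S" "1 \<notin> annihilator S J z" using z by (auto simp: annihilator_def)
next
  fix x y assume xy: "x \<in> S" "y \<in> S" "x * y \<in> annihilator S J z"
  show "x \<in> annihilator S J z \<or> y \<in> annihilator S J z"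
  proof (cases "y * z \<in> J")
    case True
    then show ?thesis using xy by (auto simp: annihilator_def)
  next
    case False
    have "annihilator S J (y * z) = annihilator S J z"
    proof (intro max)
      show "annihilator S J z \<subseteq> annihilator S J (y * z)"
        using submod_mult[OF J xy(2)] by (auto simp: annihilator_def mult.left_commute[of _ y])
    qed (use False xy z mult_mem in auto)
    moreover have "x \<in> annihilator S J (y * z)" using xy by (auto simp: annihilator_def mult.assoc)
    ultimately show ?thesis by simp
  qed
qed

lemma prime_in_prod:
  assumes "prime_in S P" "finite I" "\<And>i. i \<in> I \<Longrightarrow> f i \<in> S" "\<And>i. i \<in> I \<Longrightarrow> f i \<notin> P"
  shows "prod f I \<notin> P"
  using assms(2-4)
proof induction
  case empty then show ?case using assms(1) by (simp add: prime_in_def)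
next
  case (insert i I)
  then have "f i \<in> S" "prod f I \<in> S" by (auto intro: prod_mem)
  moreover have "f i \<notin> P" "prod f I \<notin> P" using insert by auto
  ultimately have "f i * prod f I \<notin> P" using assms(1) unfolding prime_in_def by blast
  with insert show ?case by simp
qed

text \<open>Pairwise incomparability permits an explicit element: the summand \<open>y P\<close>
  lies in \<open>m\<close> and in every prime of the family except P, so modulo P exactly one
  summand survives.\<close>

lemma prime_avoidance:
  assumes "finite \<P>" and prime: "\<And>P. P \<in> \<P> \<Longrightarrow> prime_in S P"
    and incomp: "\<And>P Q. P \<in> \<P> \<Longrightarrow> Q \<in> \<P> \<Longrightarrow> P \<subseteq> Q \<Longrightarrow> P = Q"
    and m: "submod S m" "m \<subseteq> S" "\<And>P. P \<in> \<P> \<Longrightarrow> \<not> m \<subseteq> P"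
  obtains t where "t \<in> m" "\<And>P. P \<in> \<P> \<Longrightarrow> t \<notin> P"
proof -
  have "\<forall>P\<in>\<P>. \<exists>x. x \<in> m \<and> x \<notin> P" using m(3) by blast
  then obtain g where g: "\<And>P. P \<in> \<P> \<Longrightarrow> g P \<in> m" "\<And>P. P \<in> \<P> \<Longrightarrow> g P \<notin> P" by metis
  have "\<forall>Q\<in>\<P>. \<forall>P\<in>\<P>. Q \<noteq> P \<longrightarrow> (\<exists>x. x \<in> Q \<and> x \<notin> P)" using incomp by blast
  then obtain h where h: "\<And>P Q. P \<in> \<P> \<Longrightarrow> Q \<in> \<P> \<Longrightarrow> Q \<noteq> P \<Longrightarrow> h Q P \<in> Q"
    "\<And>P Q. P \<in> \<P> \<Longrightarrow> Q \<in> \<P> \<Longrightarrow> Q \<noteq> P \<Longrightarrow> h Q P \<notin> P" by metis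
  have hS: "h Q P \<in> S" if "P \<in> \<P>" "Q \<in> \<P>" "Q \<noteq> P" for P Q
    using h(1)[OF that] prime[OF that(2)] by (auto simp: prime_in_def)
  define y where "y P = (\<Prod>Q\<in>\<P>-{P}. h Q P) * g P" for P
  have prodS: "(\<Prod>Q\<in>\<P>-{P}. h Q P) \<in> S" if "P \<in> \<P>" for P using that hS by (intro prod_mem) auto
  have ym: "y P \<in> m" if "P \<in> \<P>" for P
    unfolding y_def using submod_mult[OF m(1) prodS g(1)] that by blast
  have yP: "y P \<notin> P" if P: "P \<in> \<P>" for P
  proof -
    have "(\<Prod>Q\<in>\<P>-{P}. h Q P) \<notin> P" using assms(1) P h hS by (intro prime_in_prod prime) auto
    then show ?thesis using g[OF P] prime[OF P] prodS[OF P] m(2) unfolding y_def prime_in_def by blast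
  qed
  have yQ: "y P \<in> Q" if PQ: "P \<in> \<P>" "Q \<in> \<P>" "Q \<noteq> P" for P Q
  proof -
    have "(\<Prod>R\<in>\<P>-{P}. h R P) = (\<Prod>R\<in>\<P>-{P}-{Q}. h R P) * h Q P"
      using assms(1) PQ by (subst prod.remove[of _ Q]) (auto simp: mult.commute)
    then have "y P = ((\<Prod>R\<in>\<P>-{P}-{Q}. h R P) * g P) * h Q P"
      by (simp add: y_def algebra_simps)
    moreover have "(\<Prod>R\<in>\<P>-{P}-{Q}. h R P) * g P \<in> S"
      using hS PQ g(1)[OF PQ(1)] m(2) by (intro mult_mem prod_mem) auto
    ultimately show ?thesis using prime[OF PQ(2)] h(1)[OF PQ] submod_mult
      unfolding prime_in_def by metis
  qed
  show ?thesis
  proof (rule that)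
    show "(\<Sum>P\<in>\<P>. y P) \<in> m" using ym by (intro submod_sum[OF m(1)])
    fix P assume P: "P \<in> \<P>"
    have sub: "submod S P" using prime[OF P] by (simp add: prime_in_def)
    have rest: "(\<Sum>Q\<in>\<P>-{P}. y Q) \<in> P" using yQ P by (intro submod_sum[OF sub]) auto
    have "y P = (\<Sum>Q\<in>\<P>. y Q) - (\<Sum>Q\<in>\<P>-{P}. y Q)" using assms(1) P by (simp add: sum.remove)
    then show "(\<Sum>Q\<in>\<P>. y Q) \<notin> P" using yP[OF P] submod_diff[OF sub _ rest] by metis
  qed
qed

text \<open>The maximal elements among the annihilators \<open>(J : z)\<close> are primes covering all zero divisors,
  and they are finite in number: if \<open>z\<close> lies in the ideal generated by \<open>z\<^sub>1, \<dots>, z\<^sub>r\<close>, then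
  \<open>(J : z)\<close> contains the product of the \<open>(J : z\<^sub>i)\<close> and hence, being prime, one of them.\<close>

lemma common_nonzerodivisor:
  assumes noeth: "noetherian_over S S" and "finite \<B>" and m: "submod S m" "m \<subseteq> S"
    and no_socle: "\<And>B. B \<in> \<B> \<Longrightarrow> \<not> has_socle S m B"
  obtains t where "t \<in> m" "\<And>B. B \<in> \<B> \<Longrightarrow> nzd_mod S B t"
proof -
  \<comment> \<open>The colon ideals for all \<open>B\<close> are pooled before the maximal ones are
    taken, so that the resulting primes are pairwise incomparable and one \<open>t\<close> serves
    every \<open>B\<close>.\<close>
  define \<G> where "\<G> = {annihilator S (gen S B) z | B z. B \<in> \<B> \<and> z \<in> S \<and> z \<notin> gen S B}"
  define \<P> where "\<P> = {P \<in> \<G>. \<forall>Q\<in>\<G>. P \<subseteq> Q \<longrightarrow> Q = P}"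
  have \<G>: "submod S P \<and> P \<subseteq> S" if "P \<in> \<G>" for P
    using that submod_annihilator[OF submod_gen] by (auto simp: \<G>_def annihilator_def)
  have prime: "prime_in S P" if "P \<in> \<P>" for P
  proof -
    from that obtain B z where Bz: "B \<in> \<B>" "z \<in> S" "z \<notin> gen S B" "P = annihilator S (gen S B) z"
      by (auto simp: \<P>_def \<G>_def)
    have "annihilator S (gen S B) w \<in> \<G>" if "w \<in> S" "w \<notin> gen S B" for w
      using that Bz unfolding \<G>_def by blast
    then show ?thesis using that Bz unfolding \<P>_def
      by (auto intro!: maximal_annihilator_prime submod_gen)
  qed
  define Z where "Z B = {z \<in> S. z \<notin> gen S B \<and> annihilator S (gen S B) z \<in> \<P>}" for B
  have fin: "finite (annihilator S (gen S B) ` Z B)" if B: "B \<in> \<B>" for B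
  proof -
    have "Z B \<subseteq> S" by (auto simp: Z_def)
    then obtain F where F: "finite F" "F \<subseteq> Z B" "gen S (Z B) = gen S F"
      by (rule noetherian_over_finite_subset[OF noeth submod_self])
    have "annihilator S (gen S B) ` Z B \<subseteq> annihilator S (gen S B) ` F"
    proof
      fix P assume "P \<in> annihilator S (gen S B) ` Z B"
      then obtain z where z: "z \<in> Z B" "P = annihilator S (gen S B) z" by blast
      then have P: "P \<in> \<P>" "prime_in S P" using prime by (auto simp: Z_def)
      have "\<exists>f\<in>F. annihilator S (gen S B) f \<subseteq> P"
      proof (rule ccontr)
        assume "\<not> ?thesis"
        then have "\<forall>f\<in>F. \<exists>s. s \<in> annihilator S (gen S B) f \<and> s \<notin> P" by blast
        then obtain h where h: "\<And>f. f \<in> F \<Longrightarrow> h f \<in> annihilator S (gen S B) f"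
          "\<And>f. f \<in> F \<Longrightarrow> h f \<notin> P" by metis
        have hS: "h f \<in> S" if "f \<in> F" for f using h(1)[OF that] by (auto simp: annihilator_def)
        have pS: "prod h F \<in> S" using hS by (rule prod_mem)
        have "prod h F * f \<in> gen S B" if f: "f \<in> F" for f
        proof -
          have "prod h F * f = prod h (F - {f}) * (h f * f)"
            using F(1) f by (simp add: prod.remove algebra_simps)
          moreover have "h f * f \<in> gen S B" using h(1)[OF f] by (auto simp: annihilator_def)
          moreover have "prod h (F - {f}) \<in> S" using hS by (intro prod_mem) auto
          ultimately show ?thesis using submod_mult[OF submod_gen] by metis
        qed
        then have "F \<subseteq> {y. prod h F * y \<in> gen S B}" by blast
        moreover have "submod S {y. prod h F * y \<in> gen S B}"
          by (rule submodI) (auto simp: gen_zero distrib_left mult.left_commute[of "prod h F"]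
              intro: submod_add[OF submod_gen] submod_mult[OF submod_gen])
        ultimately have "gen S F \<subseteq> {y. prod h F * y \<in> gen S B}" by (rule gen_least[rotated])
        then have "prod h F * z \<in> gen S B" using z(1) gen_base[of z "Z B" S] F(3) by blast
        then have "prod h F \<in> P" using z(2) pS by (auto simp: annihilator_def)
        then show False using prime_in_prod[OF P(2) F(1), of h] hS h(2) by blast
      qed
      then obtain f where f: "f \<in> F" "annihilator S (gen S B) f \<subseteq> P" by blast
      then have "annihilator S (gen S B) f \<in> \<P>" using F(2) by (auto simp: Z_def)
      then have "annihilator S (gen S B) f = P" using f(2) P(1) unfolding \<P>_def by blast
      then show "P \<in> annihilator S (gen S B) ` F" using f(1) by blast
    qed
    then show ?thesis using F(1) finite_surj by blast
  qed
  have "\<P> \<subseteq> (\<Union>B\<in>\<B>. annihilator S (gen S B) ` Z B)" by (auto simp: \<P>_def \<G>_def Z_def)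
  then have finP: "finite \<P>" using fin assms(2) by (meson finite_UN_I finite_subset)
  have not_sub: "\<not> m \<subseteq> P" if "P \<in> \<P>" for P
  proof
    assume "m \<subseteq> P"
    from that obtain B z where "B \<in> \<B>" "z \<in> S" "z \<notin> gen S B" "P = annihilator S (gen S B) z"
      by (auto simp: \<P>_def \<G>_def)
    with \<open>m \<subseteq> P\<close> no_socle show False unfolding has_socle_def annihilator_def by blast
  qed
  obtain t where t: "t \<in> m" "\<And>P. P \<in> \<P> \<Longrightarrow> t \<notin> P"
    using prime_avoidance[OF finP prime _ m not_sub] unfolding \<P>_def by blast
  have "nzd_mod S B t" if B: "B \<in> \<B>" for B
    unfolding nzd_mod_def
  proof (intro ballI impI, rule ccontr)
    fix r assume r: "r \<in> S" "t * r \<in> gen S B" "r \<notin> gen S B"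
    have "annihilator S (gen S B) r \<in> \<G>" using r B unfolding \<G>_def by blast
    then obtain P where P: "P \<in> \<G>" "annihilator S (gen S B) r \<subseteq> P"
      "\<And>Q. Q \<in> \<G> \<Longrightarrow> P \<subseteq> Q \<Longrightarrow> Q = P"
      using noetherian_maximal_above[OF noeth _ \<G>] by metis
    then have "t \<in> P" using r t(1) m(2) by (auto simp: annihilator_def)
    then show False using t(2) P unfolding \<P>_def by blast
  qed
  with t(1) that show ?thesis by blast
qed

text \<open>The new witness is the cofactor \<open>u\<close> in y z = u x modulo \<open>B\<close>.
  Sending z to u is the elementary form of identifying the socles modulo x and modulo y with the
  same Ext^1 over the ring modulo \<open>B\<close>.\<close>

lemma socle_exchange_one:
  assumes m: "m \<subseteq> S" "x \<in> m" "y \<in> m" and nzd: "nzd_mod S B x" "nzd_mod S B y"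
    and socle: "has_socle S m (insert x B)"
  shows "has_socle S m (insert y B)"
proof -
  obtain z where z: "z \<in> S" "z \<notin> gen S (insert x B)" "\<And>i. i \<in> m \<Longrightarrow> i * z \<in> gen S (insert x B)"
    using socle by (auto simp: has_socle_def)
  obtain u j where u: "u \<in> S" "j \<in> gen S B" "y * z = u * x + j"
    using gen_insertE[OF z(3)[OF m(3)]] by metis
  \<comment> \<open>If u were v y modulo \<open>B\<close>, cancelling y would give z = v x modulo
    \<open>B\<close>, so z would not be a witness.\<close>
  have "u \<notin> gen S (insert y B)"
  proof
    assume "u \<in> gen S (insert y B)"
    then obtain v k where v: "v \<in> S" "k \<in> gen S B" "u = v * y + k" using gen_insertE by metis
    have "y * (z - v * x) = x * k + j" using u v by (simp add: algebra_simps)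
    then have "y * (z - v * x) \<in> gen S B"
      using submod_add[OF submod_gen submod_mult[OF submod_gen _ v(2)] u(2), of x] m by auto
    then have "z - v * x \<in> gen S B"
      using nzd_modD[OF nzd(2)] m v z by (meson diff_mem mult_mem subsetD)
    then have "v * x + (z - v * x) \<in> gen S (insert x B)"
      unfolding gen_insert_eq using v by blast
    with z show False by simp
  qed
  moreover have "i * u \<in> gen S (insert y B)" if i: "i \<in> m" for i
  proof -
    obtain c k where c: "c \<in> S" "k \<in> gen S B" "i * z = c * x + k"
      using gen_insertE[OF z(3)[OF i]] by metis
    have "x * (i * u - c * y) = i * (u * x) - y * (c * x)" by (simp add: algebra_simps)
    also have "\<dots> = i * (y * z - j) - y * (i * z - k)" using u c by simp
    also have "\<dots> = y * k - i * j" by (simp add: algebra_simps)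
    also have "\<dots> \<in> gen S B"
      using i m c u by (intro submod_diff[OF submod_gen] submod_mult[OF submod_gen]) auto
    finally have "i * u - c * y \<in> gen S B"
      using nzd_modD[OF nzd(1)] m u i c by (meson diff_mem mult_mem subsetD)
    then have "c * y + (i * u - c * y) \<in> gen S (insert y B)"
      unfolding gen_insert_eq using c by blast
    then show ?thesis by simp
  qed
  ultimately show ?thesis using u by (auto simp: has_socle_def)
qed

text \<open>From x r = c t + j it follows that t c vanishes modulo (B, x), so c = d x + k;
  cancelling x then puts r - t d into the ideal of \<open>B\<close>.\<close>

lemma nzd_mod_swap:
  assumes S: "x \<in> S" "t \<in> S" and nzd: "nzd_mod S B x" "nzd_mod S B t" "nzd_mod S (insert x B) t"
  shows "nzd_mod S (insert t B) x"
  unfolding nzd_mod_def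
proof (intro ballI impI)
  fix r assume r: "r \<in> S" "x * r \<in> gen S (insert t B)"
  obtain c j where c: "c \<in> S" "j \<in> gen S B" "x * r = c * t + j" using gen_insertE[OF r(2)] by metis
  have "t * c = r * x + (- j)" using c by (simp add: algebra_simps)
  also have "\<dots> \<in> gen S (insert x B)"
    unfolding gen_insert_eq using submod_uminus[OF submod_gen c(2)] r by blast
  finally have "c \<in> gen S (insert x B)" using nzd_modD[OF nzd(3) c(1)] by blast
  then obtain d k where d: "d \<in> S" "k \<in> gen S B" "c = d * x + k" using gen_insertE by metis
  have "x * (r - t * d) = t * k + j" using c d by (simp add: algebra_simps)
  also have "\<dots> \<in> gen S B" using c d S by (intro submod_add[OF submod_gen] submod_mult[OF submod_gen])
  finally have "r - t * d \<in> gen S B" using nzd_modD[OF nzd(1)] S d r by (meson diff_mem mult_mem)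
  then have "d * t + (r - t * d) \<in> gen S (insert t B)" unfolding gen_insert_eq using d by blast
  then show "r \<in> gen S (insert t B)" by (simp add: algebra_simps)
qed

text \<open>Regularity of \<open>t\<close> modulo every initial segment is what lets
  \<open>t\<close> pass the entries one after another; a general regular sequence does not admit
  such permutations outside local rings.\<close>

lemma reg_seq_move_front:
  assumes "set xs \<subseteq> S" "t \<in> S" "reg_seq S B xs"
    and "\<And>i. i \<le> length xs \<Longrightarrow> nzd_mod S (B \<union> set (take i xs)) t"
  shows "reg_seq S (insert t B) xs"
  using assms
proof (induction xs arbitrary: B)
  case (Cons x xs)
  have t: "nzd_mod S B t" "nzd_mod S (insert x B) t"
    using Cons.prems(4)[of 0] Cons.prems(4)[of 1] by auto
  have "nzd_mod S (insert x B \<union> set (take i xs)) t" if "i \<le> length xs" for i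
    using Cons.prems(4)[of "Suc i"] that by simp
  then have "reg_seq S (insert t (insert x B)) xs" using Cons by auto
  with Cons.prems t show ?case by (simp add: insert_commute nzd_mod_swap)
qed simp

text \<open>Any two maximal regular sequences in \<open>m\<close> have the same length: both are compared with the
  sequences obtained by exchanging their last elements for a common nonzerodivisor \<open>t\<close>, which can be
  moved to the front and divided out.\<close>

lemma socle_exchange:
  assumes noeth: "noetherian_over S S" and m: "submod S m" "m \<subseteq> S"
  shows "length xs = length ys \<Longrightarrow> set xs \<subseteq> m \<Longrightarrow> set ys \<subseteq> m \<Longrightarrow> reg_seq S B xs \<Longrightarrow> reg_seq S B ys \<Longrightarrow>
    has_socle S m (B \<union> set xs) \<Longrightarrow> has_socle S m (B \<union> set ys)"
proof (induction "length xs" arbitrary: xs ys B)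
  case (Suc n)
  obtain us x where xs: "xs = us @ [x]" using Suc(2) by (metis length_0_conv nat.distinct(1) rev_exhaust)
  obtain vs y where ys: "ys = vs @ [y]" using Suc(2,3) by (metis length_0_conv nat.distinct(1) rev_exhaust)
  have len: "length us = n" "length vs = n" using Suc(2,3) xs ys by auto
  \<comment> \<open>All initial segments of \<open>us\<close> and \<open>vs\<close>, these two
    included. At each of them the next entry of \<open>xs\<close> or \<open>ys\<close> is regular,
    so there is no socle and a common \<open>t\<close> exists.\<close>
  define \<B> where "\<B> = (\<lambda>i. B \<union> set (take i us)) ` {..n} \<union> (\<lambda>i. B \<union> set (take i vs)) ` {..n}"
  have *: "\<not> has_socle S m (B \<union> set (take i zs))"
    if "i < length zs" "reg_seq S B zs" "set zs \<subseteq> m" for zs i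
    using that not_has_socle[of S "B \<union> set (take i zs)" "zs ! i" m] nth_mem[of i zs]
    unfolding reg_seq_iff_nth by blast
  have no_socle: "\<not> has_socle S m D" if "D \<in> \<B>" for D
    using that *[of _ xs] *[of _ ys] Suc.prems len unfolding \<B>_def xs ys by auto
  obtain t where t: "t \<in> m" "\<And>D. D \<in> \<B> \<Longrightarrow> nzd_mod S D t"
    using common_nonzerodivisor[OF noeth _ m, of \<B>] no_socle by (auto simp: \<B>_def)
  have t_us: "nzd_mod S (B \<union> set (take i us)) t" if "i \<le> n" for i
    using that by (intro t(2)) (auto simp: \<B>_def)
  have t_vs: "nzd_mod S (B \<union> set (take i vs)) t" if "i \<le> n" for i
    using that by (intro t(2)) (auto simp: \<B>_def)
  have sets: "x \<in> m" "y \<in> m" "set us \<subseteq> m" "set vs \<subseteq> m" using Suc.prems xs ys by auto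
  have regs: "reg_seq S B us" "reg_seq S B vs" "nzd_mod S (B \<union> set us) x" "nzd_mod S (B \<union> set vs) y"
    using Suc.prems unfolding xs ys reg_seq_snoc by auto
  have "has_socle S m (insert x (B \<union> set us))" using Suc.prems(6) xs by simp
  then have "has_socle S m (insert t (B \<union> set us))"
    using socle_exchange_one[OF m(2) sets(1) t(1) regs(3)] t_us[of n] len by simp
  moreover have "reg_seq S (insert t B) us" "reg_seq S (insert t B) vs"
    using t_us t_vs regs sets m(2) t(1) len by (intro reg_seq_move_front; auto)+
  ultimately have "has_socle S m (insert t (B \<union> set vs))"
    using Suc(1)[of us vs "insert t B"] len sets by simp
  then have "has_socle S m (insert y (B \<union> set vs))"
    using socle_exchange_one[OF m(2) t(1) sets(2) _ regs(4)] t_vs[of n] len by simp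
  then show ?case using ys by simp
qed simp

end

section \<open>Finite free extensions\<close>

definition seq_depth :: "'a::comm_ring_1 set \<Rightarrow> 'a set \<Rightarrow> enat" where
  "seq_depth S m = Sup {enat (length xs) | xs. set xs \<subseteq> m \<and> reg_seq S {} xs}"

definition chain_dim :: "'a::comm_ring_1 set \<Rightarrow> enat" where
  "chain_dim S = Sup {enat d | d. \<exists>P :: nat \<Rightarrow> 'a set.
     (\<forall>i\<le>d. prime_in S (P i)) \<and> (\<forall>i<d. P i \<subset> P (Suc i))}"

lemma noetherian_over_subset: "noetherian_over S M \<Longrightarrow> N \<subseteq> M \<Longrightarrow> noetherian_over S N"
  by (auto simp: noetherian_over_def)

lemma prime_inD: "prime_in S P \<Longrightarrow> x * y \<in> P \<Longrightarrow> x \<in> S \<Longrightarrow> y \<in> S \<Longrightarrow> x \<in> P \<or> y \<in> P"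
  by (simp add: prime_in_def)

lemma (in comm_subring) prime_in_power:
  assumes "prime_in S P" "s \<in> S" "s ^ n \<in> P"
  shows "s \<in> P"
  using assms(3)
proof (induction n)
  case 0 then show ?case using assms(1) by (simp add: prime_in_def)
next
  case (Suc n)
  then show ?case using prime_inD[OF assms(1), of s "s ^ n"] assms(2) power_mem by auto
qed

text \<open>Independence enters through coordinates, hence in the comparison of depths; the
  comparison of dimensions rests on spanning, which makes the extension finite and so
  integral.\<close>

locale free_extension = A: comm_subring A + C: comm_subring C
  for A C :: "'a::comm_ring_1 set" +
  fixes V :: "'i set" and e :: "'i \<Rightarrow> 'a"
  assumes finite_basis: "finite V" and basis_nonempty: "V \<noteq> {}"
    and subring_subset: "A \<subseteq> C"
    and basis_mem: "\<And>v. v \<in> V \<Longrightarrow> e v \<in> C"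
    and spanning: "\<And>c. c \<in> C \<Longrightarrow> \<exists>f. (\<forall>v\<in>V. f v \<in> A) \<and> c = (\<Sum>v\<in>V. f v * e v)"
    and independent: "\<And>f v. (\<And>v. v \<in> V \<Longrightarrow> f v \<in> A) \<Longrightarrow> (\<Sum>v\<in>V. f v * e v) = 0 \<Longrightarrow> v \<in> V \<Longrightarrow> f v = 0"
    and noetherian: "noetherian_over A A"
begin

lemma coordinates_unique:
  assumes "\<And>v. v \<in> V \<Longrightarrow> f v \<in> A" "\<And>v. v \<in> V \<Longrightarrow> g v \<in> A"
    "(\<Sum>v\<in>V. f v * e v) = (\<Sum>v\<in>V. g v * e v)" "v \<in> V"
  shows "f v = g v"
proof -
  have "(\<Sum>v\<in>V. (f v - g v) * e v) = 0" using assms(3) by (simp add: algebra_simps sum_subtractf)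
  then have "f v - g v = 0" using assms by (intro independent[of "\<lambda>v. f v - g v"] A.diff_mem) auto
  then show ?thesis by simp
qed

text \<open>The extension of an ideal J of \<open>A\<close> is the direct sum of the J e_v. Indeed
  the elements with all coordinates in J form a submodule over \<open>C\<close>, since
  multiplication by c acts through a matrix over \<open>A\<close>, and this submodule contains
  \<open>B\<close>.\<close>

lemma gen_extension:
  assumes B: "B \<subseteq> A" and f: "\<And>v. v \<in> V \<Longrightarrow> f v \<in> A"
  shows "(\<Sum>v\<in>V. f v * e v) \<in> gen C B \<longleftrightarrow> (\<forall>v\<in>V. f v \<in> gen A B)"
proof
  assume "\<forall>v\<in>V. f v \<in> gen A B"
  moreover have "gen A B \<subseteq> gen C B"
    by (intro gen_least submod_restrict[OF submod_gen subring_subset]) (auto intro: gen_base)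
  ultimately have "e v * f v \<in> gen C B" if "v \<in> V" for v
    using that basis_mem submod_mult[OF submod_gen] by blast
  then show "(\<Sum>v\<in>V. f v * e v) \<in> gen C B"
    by (intro submod_sum[OF submod_gen]) (simp add: mult.commute)
next
  define N where "N = {\<Sum>v\<in>V. g v * e v | g. \<forall>v\<in>V. g v \<in> gen A B}"
  have "submod C N"
  proof (rule submodI)
    show "0 \<in> N" unfolding N_def by (intro CollectI exI[of _ "\<lambda>_. 0"]) (auto simp: gen_zero)
  next
    fix x y assume "x \<in> N" "y \<in> N"
    then obtain g h where "\<forall>v\<in>V. g v \<in> gen A B" "x = (\<Sum>v\<in>V. g v * e v)"
      "\<forall>v\<in>V. h v \<in> gen A B" "y = (\<Sum>v\<in>V. h v * e v)" by (auto simp: N_def)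
    then show "x + y \<in> N" unfolding N_def
      by (intro CollectI exI[of _ "\<lambda>v. g v + h v"])
        (auto simp: distrib_right sum.distrib intro: submod_add[OF submod_gen])
  next
    fix c x assume c: "c \<in> C" and "x \<in> N"
    then obtain g where g: "\<forall>v\<in>V. g v \<in> gen A B" "x = (\<Sum>v\<in>V. g v * e v)" by (auto simp: N_def)
    have "\<forall>v\<in>V. \<exists>k. (\<forall>u\<in>V. k u \<in> A) \<and> c * e v = (\<Sum>u\<in>V. k u * e u)"
      using spanning C.mult_mem[OF c basis_mem] by blast
    then obtain k where k: "\<And>v u. v \<in> V \<Longrightarrow> u \<in> V \<Longrightarrow> k v u \<in> A"
      "\<And>v. v \<in> V \<Longrightarrow> c * e v = (\<Sum>u\<in>V. k v u * e u)" by metis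
    have "c * x = (\<Sum>v\<in>V. g v * (c * e v))" by (simp add: g sum_distrib_left mult.left_commute)
    also have "\<dots> = (\<Sum>v\<in>V. \<Sum>u\<in>V. k v u * g v * e u)"
      by (simp add: k sum_distrib_left algebra_simps)
    also have "\<dots> = (\<Sum>u\<in>V. (\<Sum>v\<in>V. k v u * g v) * e u)"
      by (subst sum.swap) (simp add: sum_distrib_right)
    finally have "c * x = (\<Sum>u\<in>V. (\<Sum>v\<in>V. k v u * g v) * e u)" .
    moreover have "(\<Sum>v\<in>V. k v u * g v) \<in> gen A B" if "u \<in> V" for u
      using g(1) k(1) that by (intro submod_sum[OF submod_gen] submod_mult[OF submod_gen]) auto
    ultimately show "c * x \<in> N" unfolding N_def
      by (intro CollectI exI[of _ "\<lambda>u. \<Sum>v\<in>V. k v u * g v"]) simp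
  qed
  moreover have "B \<subseteq> N"
  proof
    fix b assume b: "b \<in> B"
    \<comment> \<open>\<open>1\<close> need not be a basis element, so coordinates of
      \<open>b\<close> are obtained by scaling those of \<open>1\<close>.\<close>
    obtain h where h: "\<forall>v\<in>V. h v \<in> A" "1 = (\<Sum>v\<in>V. h v * e v)" using spanning[OF C.one_mem] by blast
    have "b = b * (\<Sum>v\<in>V. h v * e v)" using h(2) by simp
    also have "\<dots> = (\<Sum>v\<in>V. (h v * b) * e v)" by (simp add: sum_distrib_left algebra_simps)
    finally have "b = (\<Sum>v\<in>V. (h v * b) * e v)" .
    moreover have "h v * b \<in> gen A B" if "v \<in> V" for v
      using h(1) that b by (intro submod_mult[OF submod_gen] gen_base) auto
    ultimately show "b \<in> N" unfolding N_def
      by (intro CollectI exI[of _ "\<lambda>v. h v * b"]) simp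
  qed
  ultimately have sub: "gen C B \<subseteq> N" by (rule gen_least)
  assume "(\<Sum>v\<in>V. f v * e v) \<in> gen C B"
  then obtain g where g: "\<forall>v\<in>V. g v \<in> gen A B" "(\<Sum>v\<in>V. f v * e v) = (\<Sum>v\<in>V. g v * e v)"
    using sub unfolding N_def by auto
  have "f v = g v" if "v \<in> V" for v
    using g A.gen_in[OF B] f that by (intro coordinates_unique[OF _ _ g(2)]) auto
  then show "\<forall>v\<in>V. f v \<in> gen A B" using g by simp
qed

lemma nzd_mod_extension:
  assumes B: "B \<subseteq> A" and x: "x \<in> A" and nzd: "nzd_mod A B x"
  shows "nzd_mod C B x"
  unfolding nzd_mod_def
proof (intro ballI impI)
  fix r assume r: "r \<in> C" "x * r \<in> gen C B"
  obtain f where f: "\<forall>v\<in>V. f v \<in> A" "r = (\<Sum>v\<in>V. f v * e v)" using spanning[OF r(1)] by blast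
  have "x * r = (\<Sum>v\<in>V. (x * f v) * e v)" by (simp add: f sum_distrib_left mult.assoc)
  then have "\<forall>v\<in>V. x * f v \<in> gen A B"
    using r(2) f x gen_extension[OF B, of "\<lambda>v. x * f v"] by (auto intro: A.mult_mem)
  then have "\<forall>v\<in>V. f v \<in> gen A B" using f nzd_modD[OF nzd] by blast
  then show "r \<in> gen C B" using gen_extension[OF B, of f] f by auto
qed

lemma reg_seq_extension:
  "set xs \<subseteq> A \<Longrightarrow> B \<subseteq> A \<Longrightarrow> reg_seq A B xs \<Longrightarrow> reg_seq C B xs"
  by (induction xs arbitrary: B) (auto intro: nzd_mod_extension)

text \<open>Multiplying the witness by a single basis element keeps it outside the extended ideal,
  because its one nonzero coordinate is the old witness.\<close>

lemma has_socle_extension: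
  assumes B: "B \<subseteq> A" and m: "m \<subseteq> A" and socle: "has_socle A m B"
  shows "has_socle C m B"
proof -
  obtain z where z: "z \<in> A" "z \<notin> gen A B" "\<And>i. i \<in> m \<Longrightarrow> i * z \<in> gen A B"
    using socle by (auto simp: has_socle_def)
  obtain v where v: "v \<in> V" using basis_nonempty by blast
  have eq: "y * e v = (\<Sum>u\<in>V. (if u = v then y else 0) * e u)" for y
  proof -
    have "(\<Sum>u\<in>V. (if u = v then y else 0) * e u) = (\<Sum>u\<in>V. if u = v then y * e u else 0)"
      by (intro sum.cong) auto
    then show ?thesis using finite_basis v by simp
  qed
  have iff: "y * e v \<in> gen C B \<longleftrightarrow> y \<in> gen A B" if "y \<in> A" for y
    unfolding eq by (subst gen_extension[OF B]) (use that v A.zero_mem gen_zero in auto)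
  have "i * (z * e v) \<in> gen C B" if "i \<in> m" for i
    using iff[of "i * z"] z that m A.mult_mem by (auto simp: mult.assoc)
  moreover have "z * e v \<notin> gen C B" "z * e v \<in> C"
    using iff[OF z(1)] z subring_subset v basis_mem C.mult_mem by auto
  ultimately show ?thesis unfolding has_socle_def by blast
qed

lemma submod_colon: "submod C {i. i * z \<in> gen C B}"
  by (rule submodI) (auto simp: gen_zero distrib_right mult.assoc
      intro: submod_add[OF submod_gen] submod_mult[OF submod_gen])

text \<open>If some power of y kills the witness z modulo \<open>B\<close>, then the last multiple
  y^k z that is nonzero modulo \<open>B\<close> is killed by y as well, and it is still killed by
  \<open>G\<close> and by the elements of \<open>Y\<close> treated before.\<close>

lemma has_socle_radical:
  assumes "finite Y" "Y \<subseteq> C" and rad: "\<And>y. y \<in> Y \<Longrightarrow> \<exists>n. y ^ n \<in> gen C G"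
    and G: "has_socle C G B"
  shows "has_socle C (G \<union> Y) B"
  using assms(1,2) rad
proof induction
  case empty then show ?case using G by simp
next
  case (insert y Y)
  then obtain z where z: "z \<in> C" "z \<notin> gen C B" "\<And>i. i \<in> G \<union> Y \<Longrightarrow> i * z \<in> gen C B"
    by (auto simp: has_socle_def)
  have y: "y \<in> C" using insert by auto
  obtain n where n: "y ^ n \<in> gen C G" using insert by auto
  have "gen C G \<subseteq> {i. i * z \<in> gen C B}"
    using z by (intro gen_least submod_colon) auto
  then have n: "y ^ n * z \<in> gen C B" using n by blast
  define l where "l = (LEAST l. y ^ l * z \<in> gen C B)"
  have l: "y ^ l * z \<in> gen C B" unfolding l_def by (rule LeastI[of _ n]) (rule n)
  then have "l \<noteq> 0" using z by (metis mult_1 power_0)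
  then obtain k where k: "l = Suc k" by (cases l) auto
  have "y ^ k * z \<notin> gen C B" using not_less_Least[of k "\<lambda>l. y ^ l * z \<in> gen C B"] k l_def by auto
  moreover have "y * (y ^ k * z) \<in> gen C B" using l by (simp add: k mult.assoc)
  moreover have "i * (y ^ k * z) \<in> gen C B" if "i \<in> G \<union> Y" for i
    using submod_mult[OF submod_gen C.power_mem[OF y] z(3)[OF that], of k]
    by (simp add: mult.left_commute)
  moreover have "y ^ k * z \<in> C" using y z C.mult_mem C.power_mem by blast
  ultimately show ?case unfolding has_socle_def by blast
qed

lemma noetherian_module: "noetherian_over A C"
proof (rule noetherian_over_subset)
  show "noetherian_over A (gen A (e ` V))"
    using A.noetherian_over_gen[OF noetherian] finite_basis by simp
  show "C \<subseteq> gen A (e ` V)"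
  proof
    fix c assume "c \<in> C"
    then obtain f where f: "\<forall>v\<in>V. f v \<in> A" "c = (\<Sum>v\<in>V. f v * e v)" using spanning by blast
    show "c \<in> gen A (e ` V)" unfolding f(2)
      using f(1) by (intro submod_sum[OF submod_gen] submod_mult[OF submod_gen] gen_base) auto
  qed
qed

lemma noetherian_extension: "noetherian_over C C"
  unfolding noetherian_over_def
proof (intro allI impI)
  fix N assume N: "submod C N" "N \<subseteq> C"
  obtain F where F: "finite F" "F \<subseteq> N" "N = gen A F"
    using noetherian_overE[OF noetherian_module submod_restrict[OF N(1) subring_subset] N(2)] .
  have "gen A F \<subseteq> gen C F"
    by (intro gen_least submod_restrict[OF submod_gen subring_subset]) (auto intro: gen_base)
  with F gen_least[OF N(1) F(2)] show "\<exists>F. finite F \<and> F \<subseteq> N \<and> N = gen C F" by blast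
qed

lemma has_socle_gen: "has_socle C (gen C G) B \<longleftrightarrow> has_socle C G B"
proof
  assume "has_socle C G B"
  then obtain z where z: "z \<in> C" "z \<notin> gen C B" "\<And>i. i \<in> G \<Longrightarrow> i * z \<in> gen C B"
    by (auto simp: has_socle_def)
  have "gen C G \<subseteq> {i. i * z \<in> gen C B}"
    using z by (intro gen_least submod_colon) auto
  with z show "has_socle C (gen C G) B" unfolding has_socle_def by blast
qed (auto simp: has_socle_def gen_base)

theorem seq_depth_extension:
  assumes G: "G \<subseteq> A" and Y: "finite Y" "Y \<subseteq> C" and rad: "\<And>y. y \<in> Y \<Longrightarrow> \<exists>n. y ^ n \<in> gen C G"
  shows "seq_depth A (gen A G) = seq_depth C (gen C (G \<union> Y))"
proof (rule antisym)
  have GC: "G \<union> Y \<subseteq> C" using G Y subring_subset by auto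
  have mA: "gen A G \<subseteq> A" by (rule A.gen_in[OF G])
  have mC: "gen C (G \<union> Y) \<subseteq> C" by (rule C.gen_in[OF GC])
  have mAC: "gen A G \<subseteq> gen C (G \<union> Y)"
    by (intro gen_least submod_restrict[OF submod_gen subring_subset]) (auto intro: gen_base)
  show "seq_depth A (gen A G) \<le> seq_depth C (gen C (G \<union> Y))"
    unfolding seq_depth_def
  proof (rule Sup_subset_mono, safe)
    fix xs assume "set xs \<subseteq> gen A G" "reg_seq A {} xs"
    then show "\<exists>ys. enat (length xs) = enat (length ys) \<and> set ys \<subseteq> gen C (G \<union> Y) \<and> reg_seq C {} ys"
      using reg_seq_extension[of xs "{}"] mA mAC by (intro exI[of _ xs]) auto
  qed
  show "seq_depth C (gen C (G \<union> Y)) \<le> seq_depth A (gen A G)"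
    unfolding seq_depth_def[of C]
  proof (rule Sup_least, safe)
    fix ys assume ys: "set ys \<subseteq> gen C (G \<union> Y)" "reg_seq C {} ys"
    let ?Q = "\<lambda>xs. set xs \<subseteq> gen A G \<and> reg_seq A {} xs"
    show "enat (length ys) \<le> seq_depth A (gen A G)"
    proof (cases "\<exists>xs. ?Q xs \<and> length ys \<le> length xs")
      case True
      then obtain xs where "?Q xs" "length ys \<le> length xs" by blast
      then have "enat (length xs) \<le> seq_depth A (gen A G)"
        unfolding seq_depth_def by (intro Sup_upper) auto
      then show ?thesis using \<open>length ys \<le> length xs\<close> by (meson enat_ord_simps(1) order_trans)
    next
      \<comment> \<open>Here \<open>length ys\<close> bounds all regular sequences in the ideal of
        \<open>A\<close>, so a longest one exists.\<close>
      case False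
      then have "\<forall>xs. ?Q xs \<longrightarrow> length xs < length ys" using not_le by blast
      moreover have "?Q []" by simp
      ultimately obtain xs where xs: "?Q xs" and max: "\<forall>zs. ?Q zs \<longrightarrow> length zs \<le> length xs"
        using ex_has_greatest_nat[of ?Q "[]" length "length ys"] by blast
      have "has_socle A (gen A G) (set xs)"
      proof (rule ccontr)
        assume "\<not> ?thesis"
        then obtain t where t: "t \<in> gen A G" "nzd_mod A (set xs) t"
          using A.common_nonzerodivisor[OF noetherian _ submod_gen mA, of "{set xs}"] by auto
        then have "?Q (xs @ [t])" using xs by (simp add: reg_seq_snoc)
        then show False using max by fastforce
      qed
      then have "has_socle C (gen A G) (set xs)" using has_socle_extension xs mA by blast
      then have "has_socle C G (set xs)" by (auto simp: has_socle_def gen_base)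
      then have "has_socle C (gen C (G \<union> Y)) (set xs)"
        unfolding has_socle_gen by (intro has_socle_radical Y rad)
      moreover have "length xs < length ys" using xs False by (meson not_le)
      moreover have "reg_seq C {} xs" "set xs \<subseteq> gen C (G \<union> Y)"
        using xs reg_seq_extension[of xs "{}"] mA mAC by auto
      \<comment> \<open>Cut to the length of \<open>xs\<close>, the sequence \<open>ys\<close> also
        acquires a socle by exchange, although its next entry is regular there.\<close>
      moreover have "reg_seq C {} (take (length xs) ys @ drop (length xs) ys)" using ys by simp
      then have "reg_seq C {} (take (length xs) ys)" unfolding reg_seq_append by blast
      moreover have "set (take (length xs) ys) \<subseteq> gen C (G \<union> Y)"
        using ys set_take_subset by fastforce
      ultimately have socle: "has_socle C (gen C (G \<union> Y)) (set (take (length xs) ys))"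
        using C.socle_exchange[OF noetherian_extension submod_gen mC, of xs "take (length xs) ys" "{}"]
        by simp
      have "nzd_mod C (set (take (length xs) ys)) (ys ! length xs)"
        using ys(2) \<open>length xs < length ys\<close> unfolding reg_seq_iff_nth by auto
      moreover have "ys ! length xs \<in> gen C (G \<union> Y)" using ys(1) \<open>length xs < length ys\<close> by auto
      ultimately show ?thesis using socle not_has_socle by blast
    qed
  qed
qed

text \<open>\<open>C\<close> is Noetherian over \<open>A\<close>, so finitely many powers of y span
  all powers; an exponent beyond them gives an integral equation.\<close>

lemma integral:
  assumes y: "y \<in> C"
  obtains n where "y ^ n \<in> gen A ((\<lambda>i. y ^ i) ` {..<n})"
proof -
  have "range (\<lambda>i. y ^ i) \<subseteq> C" using C.power_mem[OF y] by auto
  then obtain F where F: "finite F" "F \<subseteq> range (\<lambda>i. y ^ i)" "gen A (range (\<lambda>i. y ^ i)) = gen A F"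
    by (rule A.noetherian_over_finite_subset[OF noetherian_module
          submod_restrict[OF C.submod_self subring_subset]])
  then obtain J where J: "finite J" "F = (\<lambda>i. y ^ i) ` J"
    using finite_subset_image[of F "\<lambda>i. y ^ i" UNIV] by blast
  then obtain n where "J \<subseteq> {..<n}" using finite_nat_iff_bounded by auto
  then have "gen A F \<subseteq> gen A ((\<lambda>i. y ^ i) ` {..<n})" unfolding J by (intro A.gen_mono image_mono)
  moreover have "y ^ n \<in> gen A F" unfolding F(3)[symmetric] by (intro gen_base) auto
  ultimately show ?thesis using that by blast
qed

section \<open>Contraction, incomparability and going up\<close>

lemma prime_in_contraction: "prime_in C Q \<Longrightarrow> prime_in A (Q \<inter> A)"
  using subring_subset A.mult_mem A.submod_self unfolding prime_in_def
  by (intro conjI submod_Int) (blast intro: submod_restrict)+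

text \<open>No monic polynomial over \<open>A\<close> takes a value in Q at a point y of Q' outside
  Q: if Q and Q' had the same contraction, its constant term would lie in Q' \<inter> A = Q \<inter>
  A, could be removed, and a factor y cancelled, down to degree 0. This contradicts the integrality
  of y.\<close>

lemma incomparability:
  assumes Q: "prime_in C Q" and Q': "prime_in C Q'" and "Q \<subset> Q'"
  shows "Q \<inter> A \<subset> Q' \<inter> A"
proof (rule ccontr)
  assume "\<not> ?thesis"
  then have eq: "Q \<inter> A = Q' \<inter> A" using assms(3) by blast
  obtain y where y: "y \<in> Q'" "y \<notin> Q" using assms(3) by blast
  have sub: "submod C Q" "submod C Q'" "Q \<subseteq> C" "Q' \<subseteq> C" using Q Q' by (auto simp: prime_in_def)
  have yC: "y \<in> C" using y sub by auto
  have "y ^ n + r \<notin> Q" if "r \<in> gen A ((\<lambda>i. y ^ i) ` {..<n})" for n r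
    using that
  proof (induction n arbitrary: r)
    case 0
    then show ?case using Q by (auto simp: A.gen_empty prime_in_def)
  next
    case (Suc m)
    have "(\<lambda>i. y ^ i) ` {..<Suc m} = insert 1 ((\<lambda>i. y * y ^ i) ` {..<m})"
      by (simp add: lessThan_Suc_eq_insert_0 image_image)
    then have "r \<in> gen A (insert 1 ((\<lambda>i. y * y ^ i) ` {..<m}))" using Suc.prems by simp
    then obtain a r1 where a: "a \<in> A" "r1 \<in> gen A ((\<lambda>i. y * y ^ i) ` {..<m})" "r = a * 1 + r1"
      by (rule A.gen_insertE)
    have "\<exists>r2\<in>gen A ((\<lambda>i. y ^ i) ` {..<m}). r1 = y * r2"
      using a(2)
    proof (induction rule: A.gen_induct)
      case zero then show ?case by (auto intro: bexI[of _ 0] gen_zero)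
    next
      case (step s u w)
      then obtain i w' where "i < m" "u = y * y ^ i" "w' \<in> gen A ((\<lambda>i. y ^ i) ` {..<m})" "w = y * w'"
        by auto
      with step show ?case
        by (intro bexI[of _ "s * y ^ i + w'"] gen_step) (auto simp: algebra_simps)
    qed
    then obtain r2 where r2: "r2 \<in> gen A ((\<lambda>i. y ^ i) ` {..<m})" "r1 = y * r2" by blast
    have "gen A ((\<lambda>i. y ^ i) ` {..<m}) \<subseteq> C"
      using C.power_mem[OF yC] by (intro gen_least submod_restrict[OF C.submod_self subring_subset]) auto
    then have inC: "y ^ m + r2 \<in> C" using r2 C.power_mem[OF yC] by (auto intro: C.add_mem)
    show ?case
    proof
      assume asm: "y ^ Suc m + r \<in> Q"
      have "a = (y ^ Suc m + r) - (y ^ m + r2) * y" using a r2 by (simp add: algebra_simps)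
      then have "a \<in> Q'"
        using C.submod_diff[OF sub(2) _ submod_mult[OF sub(2) inC y(1)]] asm assms(3) by auto
      then have "a \<in> Q" using eq a by blast
      moreover have "y * (y ^ m + r2) = (y ^ Suc m + r) - a" using a r2 by (simp add: algebra_simps)
      ultimately have "y * (y ^ m + r2) \<in> Q" using C.submod_diff[OF sub(1) asm] by simp
      then show False using Suc.IH[OF r2(1)] y Q yC inC by (auto simp: prime_in_def)
    qed
  qed
  moreover obtain n where n: "y ^ n \<in> gen A ((\<lambda>i. y ^ i) ` {..<n})" using integral[OF yC] .
  moreover have "- (y ^ n) \<in> gen A ((\<lambda>i. y ^ i) ` {..<n})" by (rule A.submod_uminus[OF submod_gen n])
  ultimately have "y ^ n + - (y ^ n) \<notin> Q" by blast
  then show False using submod_zero[OF sub(1)] by simp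
qed

text \<open>An ideal maximal among those that contain J and contract into P meets A - P once it is
  enlarged, hence is prime. Integrality then forces its contraction to be all of P.\<close>

lemma going_up:
  assumes P: "prime_in A P" and J: "submod C J" "J \<subseteq> C" "J \<inter> A \<subseteq> P"
  obtains Q where "prime_in C Q" "J \<subseteq> Q" "Q \<inter> A = P"
proof -
  have PA: "submod A P" "P \<subseteq> A" "1 \<notin> P" "\<And>x y. x \<in> A \<Longrightarrow> y \<in> A \<Longrightarrow> x * y \<in> P \<Longrightarrow> x \<in> P \<or> y \<in> P"
    using P by (auto simp: prime_in_def)
  define \<F> where "\<F> = {N. submod C N \<and> N \<subseteq> C \<and> N \<inter> A \<subseteq> P}"
  have "J \<in> \<F>" using J by (simp add: \<F>_def)
  then obtain Q where Q: "Q \<in> \<F>" "J \<subseteq> Q" "\<And>N. N \<in> \<F> \<Longrightarrow> Q \<subseteq> N \<Longrightarrow> N = Q"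
    by (rule C.noetherian_maximal_above[OF noetherian_extension]) (auto simp: \<F>_def)
  have sub: "submod C Q" "Q \<subseteq> C" "Q \<inter> A \<subseteq> P" using Q by (auto simp: \<F>_def)
  have meet: "\<exists>c\<in>C. \<exists>q\<in>Q. c * x + q \<in> A \<and> c * x + q \<notin> P" if x: "x \<in> C" "x \<notin> Q" for x
  proof (rule ccontr)
    assume none: "\<not> ?thesis"
    let ?N = "gen C (insert x Q)"
    have N: "y \<in> ?N \<longleftrightarrow> (\<exists>c\<in>C. \<exists>q\<in>Q. y = c * x + q)" for y
      unfolding C.gen_insert_eq C.gen_submod[OF sub(1)] by blast
    have "?N \<in> \<F>"
      unfolding \<F>_def
    proof (intro CollectI conjI subsetI submod_gen)
      fix y assume y: "y \<in> ?N"
      then show "y \<in> C" using C.gen_in[of "insert x Q"] x sub by blast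
    next
      fix y assume y: "y \<in> ?N \<inter> A"
      then obtain c q where "c \<in> C" "q \<in> Q" "y = c * x + q" using N by blast
      with y none show "y \<in> P" by blast
    qed
    moreover have "Q \<subseteq> ?N" by (auto intro: gen_base)
    ultimately have "?N = Q" by (rule Q(3))
    moreover have "x \<in> ?N" by (auto intro: gen_base)
    ultimately show False using x by simp
  qed
  have "prime_in C Q"
    unfolding prime_in_def
  proof (intro conjI ballI impI sub)
    show "1 \<notin> Q" using sub PA A.one_mem by blast
    fix x y assume xy: "x \<in> C" "y \<in> C" "x * y \<in> Q"
    show "x \<in> Q \<or> y \<in> Q"
    proof (rule ccontr)
      assume "\<not> ?thesis"
      then obtain c q d r where c: "c \<in> C" "q \<in> Q" "c * x + q \<in> A" "c * x + q \<notin> P"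
        and d: "d \<in> C" "r \<in> Q" "d * y + r \<in> A" "d * y + r \<notin> P" using meet xy by metis
      have "(c * x + q) * (d * y + r) = (c * d) * (x * y) + ((c * x) * r + (d * y + r) * q)"
        by (simp add: algebra_simps)
      also have "\<dots> \<in> Q"
      proof (intro submod_add[OF sub(1)])
        show "c * d * (x * y) \<in> Q" "c * x * r \<in> Q" "(d * y + r) * q \<in> Q"
          using c d xy subring_subset C.mult_mem submod_mult[OF sub(1)] by blast+
      qed
      finally have "(c * x + q) * (d * y + r) \<in> P" using c d A.mult_mem sub by blast
      with c d PA show False by blast
    qed
  qed
  moreover have "P \<subseteq> Q"
  proof (rule ccontr)
    assume "\<not> P \<subseteq> Q"
    then obtain p where p: "p \<in> P" "p \<notin> Q" by blast
    then have pA: "p \<in> A" "p \<in> C" using PA subring_subset by auto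
    then obtain c q where c: "c \<in> C" "q \<in> Q" "c * p + q \<in> A" "c * p + q \<notin> P" using meet p by blast
    define s where "s = c * p + q"
    have sC: "s \<in> C" using c subring_subset by (auto simp: s_def)
    \<comment> \<open>Modulo \<open>Q\<close> the element p c equals s, so powers of p c may be
      replaced by powers of s, which lie in \<open>A\<close>.\<close>
    have pow: "(p * c) ^ i - s ^ i \<in> Q" for i
    proof (induction i)
      case 0 then show ?case using submod_zero[OF sub(1)] by simp
    next
      case (Suc i)
      have "(p * c) ^ Suc i - s ^ Suc i = (p * c) * ((p * c) ^ i - s ^ i) + (- (s ^ i)) * q"
        by (simp add: s_def algebra_simps)
      also have "\<dots> \<in> Q" using Suc c pA sC
        by (intro submod_add[OF sub(1)] submod_mult[OF sub(1)] C.mult_mem C.uminus_mem C.power_mem)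
      finally show ?case .
    qed
    obtain n where n: "c ^ n \<in> gen A ((\<lambda>i. c ^ i) ` {..<n})" using integral[OF c(1)] .
    \<comment> \<open>Multiplying a combination of the c^i with i < n by p^n leaves at least one
      factor p in each term, so the result is in P modulo \<open>Q\<close>. Applied to the integral
      equation of c this puts s^n into P.\<close>
    have "\<exists>t\<in>P. p ^ n * r - t \<in> Q" if "r \<in> gen A ((\<lambda>i. c ^ i) ` {..<n})" for r
      using that
    proof (induction rule: A.gen_induct)
      case zero
      show ?case using submod_zero[OF sub(1)] submod_zero[OF PA(1)] by (intro bexI[of _ 0]) auto
    next
      case (step a u w)
      then obtain i t where it: "i < n" "u = c ^ i" "t \<in> P" "p ^ n * w - t \<in> Q" by auto
      define k where "k = n - i - 1"
      have k: "n = Suc (i + k)" using it(1) by (simp add: k_def)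
      have sA: "s \<in> A" using c by (simp add: s_def)
      have "(a * p ^ k * s ^ i) * p + t \<in> P"
        using it step p pA sA
        by (intro submod_add[OF PA(1)] submod_mult[OF PA(1)] A.mult_mem A.power_mem) auto
      moreover have "p ^ n * (a * u + w) - ((a * p ^ k * s ^ i) * p + t) =
          (a * p ^ k * p) * ((p * c) ^ i - s ^ i) + (p ^ n * w - t)"
        by (simp add: k it(2) power_add power_mult_distrib algebra_simps)
      moreover have "(a * p ^ k * p) * ((p * c) ^ i - s ^ i) + (p ^ n * w - t) \<in> Q"
        using pow it(4) step pA subring_subset
        by (intro submod_add[OF sub(1)] submod_mult[OF sub(1)] C.mult_mem C.power_mem) auto
      ultimately show ?case by metis
    qed
    from this[OF n] obtain t where t: "t \<in> P" "(p * c) ^ n - t \<in> Q"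
      by (auto simp: power_mult_distrib)
    have sA: "s \<in> A" using c by (simp add: s_def)
    have "s ^ n - t = ((p * c) ^ n - t) - ((p * c) ^ n - s ^ n)" by simp
    also have "\<dots> \<in> Q" by (rule C.submod_diff[OF sub(1) t(2) pow])
    finally have "s ^ n - t \<in> P" using sub(3) A.diff_mem[OF A.power_mem[OF sA]] t PA by blast
    then have "(s ^ n - t) + t \<in> P" by (rule submod_add[OF PA(1) _ t(1)])
    then have "s \<in> P" using A.prime_in_power[OF P sA] by simp
    then show False using c by (simp add: s_def)
  qed
  ultimately show ?thesis using that Q(2) sub PA by blast
qed

theorem chain_dim_extension: "chain_dim A = chain_dim C"
proof (rule antisym)
  show "chain_dim C \<le> chain_dim A"
    unfolding chain_dim_def
  proof (rule Sup_subset_mono, safe)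
    fix d Q assume "\<forall>i\<le>d. prime_in C (Q i)" "\<forall>i<d. Q i \<subset> Q (Suc i)"
    then show "\<exists>d'. enat d = enat d' \<and> (\<exists>P. (\<forall>i\<le>d'. prime_in A (P i)) \<and> (\<forall>i<d'. P i \<subset> P (Suc i)))"
      using prime_in_contraction incomparability
      by (intro exI[of _ d] conjI exI[of _ "\<lambda>i. Q i \<inter> A"]) auto
  qed
  \<comment> \<open>Chains are lifted from the bottom, starting from the zero ideal, with weak
    inclusions; strictness follows afterwards from the distinct contractions.\<close>
  have lift: "\<exists>Q. (\<forall>i\<le>d. prime_in C (Q i) \<and> Q i \<inter> A = P i) \<and> (\<forall>i<d. Q i \<subseteq> Q (Suc i))"
    if "\<forall>i\<le>d. prime_in A (P i)" "\<forall>i<d. P i \<subset> P (Suc i)" for d and P :: "nat \<Rightarrow> 'a set"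
    using that
  proof (induction d)
    case 0
    then have P0: "prime_in A (P 0)" "{0} \<inter> A \<subseteq> P 0" by (auto simp: prime_in_def submod_zero)
    have "{0} \<subseteq> C" using C.zero_mem by simp
    then obtain Q where "prime_in C Q" "Q \<inter> A = P 0"
      using going_up[OF P0(1) submod_zero_set _ P0(2)] by blast
    then show ?case by (intro exI[of _ "\<lambda>_. Q"]) auto
  next
    case (Suc d)
    then obtain Q where Q: "\<forall>i\<le>d. prime_in C (Q i) \<and> Q i \<inter> A = P i" "\<forall>i<d. Q i \<subseteq> Q (Suc i)"
      by auto
    have "prime_in A (P (Suc d))" "submod C (Q d)" "Q d \<subseteq> C" "Q d \<inter> A \<subseteq> P (Suc d)"
      using Suc.prems Q by (auto simp: prime_in_def)
    then obtain Q' where "prime_in C Q'" "Q d \<subseteq> Q'" "Q' \<inter> A = P (Suc d)" by (rule going_up)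
    with Q show ?case
      by (intro exI[of _ "Q(Suc d := Q')"]) (auto simp: le_Suc_eq less_Suc_eq)
  qed
  show "chain_dim A \<le> chain_dim C"
    unfolding chain_dim_def
  proof (rule Sup_subset_mono, safe)
    fix d P assume P: "\<forall>i\<le>d. prime_in A (P i)" "\<forall>i<d. P i \<subset> P (Suc i)"
    then obtain Q where Q: "\<forall>i\<le>d. prime_in C (Q i) \<and> Q i \<inter> A = P i" "\<forall>i<d. Q i \<subseteq> Q (Suc i)"
      using lift[OF P] by blast
    have "Q i \<subset> Q (Suc i)" if "i < d" for i
    proof -
      have "Q i \<inter> A = P i" "Q (Suc i) \<inter> A = P (Suc i)" using Q(1) that by simp_all
      moreover have "P i \<noteq> P (Suc i)" using P(2) that by blast
      ultimately have "Q i \<noteq> Q (Suc i)" by auto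
      then show ?thesis using Q(2) that by blast
    qed
    with Q(1) show "\<exists>d'. enat d = enat d' \<and> (\<exists>P. (\<forall>i\<le>d'. prime_in C (P i)) \<and> (\<forall>i<d'. P i \<subset> P (Suc i)))"
      by (intro exI[of _ d] conjI exI[of _ Q]) auto
  qed
qed

end

section \<open>Transfer along ring isomorphisms\<close>

text \<open>The bridge to rings given as records, for which dimension and depth are defined;
  \<open>UNIV\<close> gives the polynomial ring itself.\<close>

definition ring_on :: "'a::comm_ring_1 set \<Rightarrow> 'a ring" where
  "ring_on S = \<lparr>carrier = S, monoid.mult = (*), one = 1, ring.zero = 0, add = (+)\<rparr>"

lemma ring_on_simps [simp]:
  "carrier (ring_on S) = S" "monoid.mult (ring_on S) = (*)" "one (ring_on S) = 1"
  "ring.zero (ring_on S) = 0" "add (ring_on S) = (+)"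
  by (simp_all add: ring_on_def)

context comm_subring
begin

lemma cring_ring_on: "cring (ring_on S)"
proof (intro cringI abelian_groupI comm_monoidI)
  fix x assume "x \<in> carrier (ring_on S)"
  then show "\<exists>y\<in>carrier (ring_on S). y \<oplus>\<^bsub>ring_on S\<^esub> x = \<zero>\<^bsub>ring_on S\<^esub>"
    by (intro bexI[of _ "- x"]) (auto intro: uminus_mem)
qed (auto simp: algebra_simps intro: zero_mem one_mem add_mem mult_mem)

lemma ring_ring_on: "ring (ring_on S)"
  using cring_ring_on by (rule cring.axioms)

lemma a_inv_ring_on: "x \<in> S \<Longrightarrow> \<ominus>\<^bsub>ring_on S\<^esub> x = - x"
proof -
  interpret R: cring "ring_on S" by (rule cring_ring_on)
  assume "x \<in> S"
  then show ?thesis using R.minus_equality[of "- x" x] uminus_mem by simp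
qed

lemma ideal_ring_on_iff: "ideal I (ring_on S) \<longleftrightarrow> submod S I \<and> I \<subseteq> S"
proof
  assume "ideal I (ring_on S)"
  then interpret I: ideal I "ring_on S" .
  show "submod S I \<and> I \<subseteq> S"
    using additive_subgroup.zero_closed[OF I.is_additive_subgroup]
      additive_subgroup.a_closed[OF I.is_additive_subgroup] I.I_l_closed I.a_subset
    by (auto intro!: submodI)
next
  assume I: "submod S I \<and> I \<subseteq> S"
  interpret R: cring "ring_on S" by (rule cring_ring_on)
  show "ideal I (ring_on S)"
  proof (rule idealI[OF R.ring_axioms])
    have "subgroup I (add_monoid (ring_on S))"
    proof (rule R.add.subgroupI)
      fix x assume "x \<in> I"
      moreover have "\<ominus>\<^bsub>ring_on S\<^esub> x = - x" using \<open>x \<in> I\<close> I by (intro a_inv_ring_on) auto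
      ultimately show "\<ominus>\<^bsub>ring_on S\<^esub> x \<in> I" using I submod_uminus by simp
    qed (use I submod_zero submod_add in auto)
    then show "subgroup I (add_monoid (ring_on S))" .
  next
    fix x a assume "x \<in> I" "a \<in> carrier (ring_on S)"
    then have "a * x \<in> I" using I submod_mult by auto
    then show "a \<otimes>\<^bsub>ring_on S\<^esub> x \<in> I" "x \<otimes>\<^bsub>ring_on S\<^esub> a \<in> I" by (simp_all add: mult.commute)
  qed
qed

lemma primeideal_ring_on_iff: "primeideal P (ring_on S) \<longleftrightarrow> prime_in S P"
proof
  assume P: "primeideal P (ring_on S)"
  then interpret P: primeideal P "ring_on S" .
  have "1 \<notin> P" using P.one_imp_carrier P.I_notcarr by auto
  moreover have "submod S P \<and> P \<subseteq> S" using P.ideal_axioms ideal_ring_on_iff by blast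
  ultimately show "prime_in S P" using P.I_prime by (auto simp: prime_in_def)
next
  assume P: "prime_in S P"
  have "ideal P (ring_on S)" using P ideal_ring_on_iff by (auto simp: prime_in_def)
  then show "primeideal P (ring_on S)"
    using P one_mem by (intro primeidealI cring_ring_on) (auto simp: prime_in_def)
qed

lemma genideal_ring_on: "B \<subseteq> S \<Longrightarrow> Idl\<^bsub>ring_on S\<^esub> B = gen S B"
proof (rule antisym)
  assume B: "B \<subseteq> S"
  show "Idl\<^bsub>ring_on S\<^esub> B \<subseteq> gen S B"
    unfolding genideal_def ideal_ring_on_iff
    using submod_gen gen_in[OF B] gen_base by (intro Inter_lower) auto
  show "gen S B \<subseteq> Idl\<^bsub>ring_on S\<^esub> B"
    unfolding genideal_def ideal_ring_on_iff by (auto intro: subsetD[OF gen_least])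
qed

lemma krull_dim_ring_on: "krull_dim (ring_on S) = chain_dim S"
  unfolding krull_dim_def chain_dim_def primeideal_ring_on_iff ..

text \<open>Entries in \<open>m\<close> generate an ideal inside \<open>m\<close>, which misses 1,
  so the properness clause of \<open>regular_sequence\<close> holds automatically.\<close>

lemma depth_ring_on:
  assumes m: "submod S m" "m \<subseteq> S" "1 \<notin> m"
  shows "depth (ring_on S) m = seq_depth S m"
proof -
  have "regular_sequence (ring_on S) xs \<longleftrightarrow> reg_seq S {} xs" if xs: "set xs \<subseteq> m" for xs
  proof -
    have "set (take i xs) \<subseteq> S" for i using xs m(2) set_take_subset by fastforce
    then have Idl: "Idl\<^bsub>ring_on S\<^esub> (set (take i xs)) = gen S (set (take i xs))" for i
      by (rule genideal_ring_on)
    have "Idl\<^bsub>ring_on S\<^esub> (set xs) \<subseteq> m" using Idl[of "length xs"] gen_least[OF m(1) xs] by simp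
    then have "Idl\<^bsub>ring_on S\<^esub> (set xs) \<noteq> S" using m(3) one_mem by blast
    then show ?thesis using xs m(2)
      by (auto simp: regular_sequence_def Idl reg_seq_iff_nth nzd_mod_def)
  qed
  then show ?thesis unfolding depth_def seq_depth_def by metis
qed

end

section \<open>Invariance of dimension and depth under ring isomorphisms\<close>

context
  fixes R :: "('a, 'm) ring_scheme" and R' :: "('b, 'n) ring_scheme" and h :: "'a \<Rightarrow> 'b"
  assumes R: "cring R" and R': "cring R'" and h: "h \<in> ring_iso R R'"
begin

lemma iso_hom_ring: "ring_hom_ring R R' h"
  using R R' h by (auto simp: ring_iso_def cring_def intro!: ring_hom_ringI2)

lemma iso_inverse: "inv_into (carrier R) h \<in> ring_iso R' R"
  using R h by (intro ring_iso_set_sym) (auto simp: cring_def)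

lemma iso_inj: "inj_on h (carrier R)" and iso_surj: "h ` carrier R = carrier R'"
  using h by (auto simp: ring_iso_def bij_betw_def)

text \<open>Images are rewritten as preimages under the inverse map because preimages of ideals and
  of prime ideals under homomorphisms are again such.\<close>

lemma iso_image_eq_vimage:
  assumes "I \<subseteq> carrier R"
  shows "h ` I = {r \<in> carrier R'. inv_into (carrier R) h r \<in> I}"
proof (intro equalityI subsetI)
  fix y assume "y \<in> h ` I"
  then show "y \<in> {r \<in> carrier R'. inv_into (carrier R) h r \<in> I}"
    using assms iso_surj inv_into_f_f[OF iso_inj] by auto
next
  fix y assume y: "y \<in> {r \<in> carrier R'. inv_into (carrier R) h r \<in> I}"
  then have "y = h (inv_into (carrier R) h y)" using iso_surj by (simp add: f_inv_into_f)
  then show "y \<in> h ` I" using y by blast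
qed

lemma iso_inverse_hom_ring: "ring_hom_ring R' R (inv_into (carrier R) h)"
  using R R' iso_inverse by (auto simp: ring_iso_def cring_def intro!: ring_hom_ringI2)

lemma iso_ideal: "ideal I R \<Longrightarrow> ideal (h ` I) R'"
  using ring_hom_ring.ideal_vimage[OF iso_inverse_hom_ring]
  by (simp add: iso_image_eq_vimage additive_subgroup.a_subset ideal.axioms(1))

lemma iso_primeideal: "primeideal I R \<Longrightarrow> primeideal (h ` I) R'"
  using ring_hom_ring.primeideal_vimage[OF iso_inverse_hom_ring R']
  by (simp add: iso_image_eq_vimage additive_subgroup.a_subset ideal.axioms(1) primeideal.axioms(1))

lemma iso_genideal:
  assumes B: "B \<subseteq> carrier R"
  shows "h ` (Idl\<^bsub>R\<^esub> B) = Idl\<^bsub>R'\<^esub> (h ` B)"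
proof (rule antisym)
  interpret R: cring R by fact
  interpret R': cring R' by fact
  have hB: "h ` B \<subseteq> carrier R'" using B iso_surj by blast
  have "ideal {r \<in> carrier R. h r \<in> Idl\<^bsub>R'\<^esub> (h ` B)} R"
    by (rule ring_hom_ring.ideal_vimage[OF iso_hom_ring R'.genideal_ideal[OF hB]])
  then have "Idl\<^bsub>R\<^esub> B \<subseteq> {r \<in> carrier R. h r \<in> Idl\<^bsub>R'\<^esub> (h ` B)}"
    using B R'.genideal_self[OF hB] by (intro R.genideal_minimal) auto
  then show "h ` (Idl\<^bsub>R\<^esub> B) \<subseteq> Idl\<^bsub>R'\<^esub> (h ` B)" by auto
  show "Idl\<^bsub>R'\<^esub> (h ` B) \<subseteq> h ` (Idl\<^bsub>R\<^esub> B)"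
    using R.genideal_self[OF B] by (intro R'.genideal_minimal iso_ideal R.genideal_ideal B) auto
qed

lemma iso_regular_sequence:
  assumes "regular_sequence R xs"
  shows "regular_sequence R' (map h xs)"
  unfolding regular_sequence_def
proof (intro conjI allI impI ballI)
  interpret R: cring R by fact
  have xs: "set xs \<subseteq> carrier R" using assms by (simp add: regular_sequence_def)
  then show "set (map h xs) \<subseteq> carrier R'" using iso_surj by auto
  have img: "Idl\<^bsub>R'\<^esub> (set (take i (map h xs))) = h ` (Idl\<^bsub>R\<^esub> (set (take i xs)))" for i
    using iso_genideal[of "set (take i xs)"] xs set_take_subset[of i xs] by (auto simp: take_map)
  have sub: "Idl\<^bsub>R\<^esub> B \<subseteq> carrier R" if "B \<subseteq> carrier R" for B
    using R.genideal_ideal[OF that] by (simp add: additive_subgroup.a_subset ideal.axioms(1))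
  fix i r assume i: "i < length (map h xs)" and r: "r \<in> carrier R'"
    and mem: "map h xs ! i \<otimes>\<^bsub>R'\<^esub> r \<in> Idl\<^bsub>R'\<^esub> (set (take i (map h xs)))"
  obtain s where s: "s \<in> carrier R" "r = h s" using r iso_surj by blast
  have xi: "xs ! i \<in> carrier R" using i xs by auto
  have "h (xs ! i \<otimes>\<^bsub>R\<^esub> s) \<in> h ` (Idl\<^bsub>R\<^esub> (set (take i xs)))"
    using mem i s xi unfolding img by (simp add: ring_iso_memE(2)[OF h])
  moreover have "Idl\<^bsub>R\<^esub> (set (take i xs)) \<subseteq> carrier R"
    using xs set_take_subset[of i xs] by (intro sub) auto
  ultimately have "xs ! i \<otimes>\<^bsub>R\<^esub> s \<in> Idl\<^bsub>R\<^esub> (set (take i xs))"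
    using iso_inj xi s by (simp add: inj_on_image_mem_iff)
  then have "s \<in> Idl\<^bsub>R\<^esub> (set (take i xs))"
    using assms i s by (simp add: regular_sequence_def)
  then show "r \<in> Idl\<^bsub>R'\<^esub> (set (take i (map h xs)))" unfolding img s(2) by blast
next
  interpret R: cring R by fact
  have xs: "set xs \<subseteq> carrier R" "Idl\<^bsub>R\<^esub> (set xs) \<noteq> carrier R"
    using assms by (auto simp: regular_sequence_def)
  have "Idl\<^bsub>R\<^esub> (set xs) \<subseteq> carrier R"
    using R.genideal_ideal[OF xs(1)] by (simp add: additive_subgroup.a_subset ideal.axioms(1))
  then have "h ` (Idl\<^bsub>R\<^esub> (set xs)) \<noteq> h ` carrier R"
    using xs(2) iso_inj by (simp add: inj_on_image_eq_iff)
  then show "Idl\<^bsub>R'\<^esub> (set (map h xs)) \<noteq> carrier R'"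
    using iso_genideal[OF xs(1)] iso_surj by simp
qed

text \<open>One inequality is enough, here and for depth; the inverse isomorphism supplies the
  other.\<close>

lemma iso_krull_dim_le: "krull_dim R \<le> krull_dim R'"
  unfolding krull_dim_def
proof (rule Sup_subset_mono, safe)
  fix d P assume P: "\<forall>i\<le>d. primeideal (P i) R" "\<forall>i<d. P i \<subset> P (Suc i)"
  have "h ` P i \<subset> h ` P (Suc i)" if "i < d" for i
  proof -
    have "P (Suc i) \<subseteq> carrier R"
      using P(1) that by (simp add: Suc_leI additive_subgroup.a_subset ideal.axioms(1) primeideal.axioms(1))
    moreover have "P i \<subset> P (Suc i)" using P(2) that by simp
    ultimately have "h ` P i \<noteq> h ` P (Suc i)"
      using inj_on_image_eq_iff[OF iso_inj, of "P i" "P (Suc i)"] by auto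
    then show ?thesis using \<open>P i \<subset> P (Suc i)\<close> by auto
  qed
  then show "\<exists>d'. enat d = enat d' \<and> (\<exists>P. (\<forall>i\<le>d'. primeideal (P i) R') \<and> (\<forall>i<d'. P i \<subset> P (Suc i)))"
    using iso_primeideal P(1) by (intro exI[of _ d] conjI exI[of _ "\<lambda>i. h ` P i"]) simp_all
qed

lemma iso_depth_le: "depth R m \<le> depth R' (h ` m)"
  unfolding depth_def
proof (rule Sup_subset_mono, safe)
  fix xs assume "set xs \<subseteq> m" "regular_sequence R xs"
  then show "\<exists>ys. enat (length xs) = enat (length ys) \<and> set ys \<subseteq> h ` m \<and> regular_sequence R' ys"
    using iso_regular_sequence by (intro exI[of _ "map h xs"]) auto
qed

end

lemma
  assumes R: "cring R" and R': "cring R'" and h: "h \<in> ring_iso R R'"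
  shows krull_dim_iso: "krull_dim R = krull_dim R'"
    and depth_iso: "m \<subseteq> carrier R \<Longrightarrow> depth R m = depth R' (h ` m)"
proof -
  note inverse = iso_inverse[OF R R' h]
  show "krull_dim R = krull_dim R'"
    using iso_krull_dim_le[OF R R' h] iso_krull_dim_le[OF R' R inverse] by (rule antisym)
  assume "m \<subseteq> carrier R"
  then have "inv_into (carrier R) h ` h ` m = m"
    using h by (auto simp: ring_iso_def bij_betw_def inv_into_image_cancel)
  then show "depth R m = depth R' (h ` m)"
    using iso_depth_le[OF R R' h, of m] iso_depth_le[OF R' R inverse, of "h ` m"] by simp
qed

section \<open>Semigroup rings as subrings of polynomial rings\<close>

text \<open>The linear map induced by a map of exponents. Toric maps, inclusions of variables and
  the class map \<Psi> all take this form, and their composites come from composing exponent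
  maps.\<close>

definition push :: "('m \<Rightarrow> 'z) \<Rightarrow> ('m \<Rightarrow>\<^sub>0 'k::comm_ring_1) \<Rightarrow> ('z \<Rightarrow>\<^sub>0 'k)" where
  "push g f = (\<Sum>m\<in>Poly_Mapping.keys f.
     Poly_Mapping.single (g m) (Poly_Mapping.lookup f m))"

lemma push_superset:
  assumes "finite M" "Poly_Mapping.keys f \<subseteq> M"
  shows "push g f = (\<Sum>m\<in>M. Poly_Mapping.single (g m) (Poly_Mapping.lookup f m))"
  unfolding push_def using assms
  by (intro sum.mono_neutral_left) (auto simp: in_keys_iff)

lemma push_zero [simp]: "push g 0 = 0"
  by (simp add: push_def)

lemma push_single [simp]: "push g (Poly_Mapping.single m c) = Poly_Mapping.single (g m) c"
  by (simp add: push_def)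

lemma push_add: "push g (f + f') = push g f + push g f'"
proof -
  let ?M = "Poly_Mapping.keys f \<union> Poly_Mapping.keys f'"
  have "Poly_Mapping.keys (f + f') \<subseteq> ?M" by (rule Poly_Mapping.keys_add)
  then show ?thesis
    by (simp add: push_superset[of ?M] lookup_add single_add sum.distrib)
qed

lemma push_diff: "push g (f - f') = push g f - push g f'"
  using push_add[of g "f - f'" f'] by simp

lemma push_sum: "push g (\<Sum>i\<in>I. f i) = (\<Sum>i\<in>I. push g (f i))"
  by (induction I rule: infinite_finite_induct) (auto simp: push_add)

lemma sum_single: "(\<Sum>m\<in>Poly_Mapping.keys f. Poly_Mapping.single m (Poly_Mapping.lookup f m)) = f"
proof (rule poly_mapping_eqI)
  fix k
  show "Poly_Mapping.lookup (\<Sum>m\<in>Poly_Mapping.keys f.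
      Poly_Mapping.single m (Poly_Mapping.lookup f m)) k = Poly_Mapping.lookup f k"
    by (simp add: lookup_sum lookup_single when_def sum.delta in_keys_iff)
qed

lemma push_push: "push g (push h f) = push (\<lambda>m. g (h m)) f"
proof -
  have "push g (push h f) =
      (\<Sum>m\<in>Poly_Mapping.keys f. push g (Poly_Mapping.single (h m) (Poly_Mapping.lookup f m)))"
    by (simp only: push_def[of h f] push_sum)
  then show ?thesis by (simp only: push_single push_def[of "\<lambda>m. g (h m)" f])
qed

text \<open>Multiplication by a monomial becomes a translation inside \<open>g\<close>, with no
  additivity of \<open>g\<close>; this matters for \<Psi>, whose residue component is not
  additive.\<close>

lemma push_mult_single:
  "push g (Poly_Mapping.single l c * f) = Poly_Mapping.single 0 c * push (\<lambda>m. g (l + m)) f"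
  for g :: "'m::comm_monoid_add \<Rightarrow> 'z::comm_monoid_add"
proof -
  have "Poly_Mapping.single l c * f = (\<Sum>m\<in>Poly_Mapping.keys f.
      Poly_Mapping.single (l + m) (c * Poly_Mapping.lookup f m))"
    using arg_cong[OF sum_single[of f], of "\<lambda>x. Poly_Mapping.single l c * x"]
    by (simp only: sum_distrib_left mult_single)
  then have "push g (Poly_Mapping.single l c * f) = (\<Sum>m\<in>Poly_Mapping.keys f.
      Poly_Mapping.single (g (l + m)) (c * Poly_Mapping.lookup f m))"
    by (simp only: push_sum push_single)
  then show ?thesis by (simp add: push_def sum_distrib_left mult_single)
qed

lemma push_mult:
  fixes g :: "'m::comm_monoid_add \<Rightarrow> 'z::comm_monoid_add"
  assumes g: "\<And>l m. g (l + m) = g l + g m"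
  shows "push g (f * f') = push g f * push g f'"
proof -
  have single: "push g (Poly_Mapping.single l c * f') = Poly_Mapping.single (g l) c * push g f'" for l c
  proof -
    have "push (\<lambda>m. g (l + m)) f' = Poly_Mapping.single (g l) 1 * push g f'"
      by (simp add: push_def g sum_distrib_left mult_single)
    then show ?thesis
      by (simp add: push_mult_single mult_single flip: mult.assoc)
  qed
  have "push g (f * f') = push g ((\<Sum>m\<in>Poly_Mapping.keys f.
      Poly_Mapping.single m (Poly_Mapping.lookup f m)) * f')"
    by (simp only: sum_single)
  also have "\<dots> = push g f * push g f'"
    by (simp only: sum_distrib_right push_sum single push_def[of g f])
  finally show ?thesis .
qed

text \<open>\<open>h\<close> is constant on the fibres of \<open>g\<close> and hence factors through
  it, the factor being defined by chosen preimages; so \<open>push h f\<close> is a linear image of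
  \<open>push g f\<close>.\<close>

lemma push_eq_0_factor:
  assumes "\<And>m m'. g m = g m' \<Longrightarrow> h m = h m'" "push g f = 0"
  shows "push h f = 0"
proof -
  have "h m = h (inv_into UNIV g (g m))" for m by (rule assms(1)) (simp add: f_inv_into_f)
  then have "push h f = push (\<lambda>m. h (inv_into UNIV g (g m))) f" by simp
  also have "\<dots> = push (\<lambda>z. h (inv_into UNIV g z)) (push g f)" by (simp add: push_push)
  finally show ?thesis using assms(2) by simp
qed

lemma sum_single_inj_zero:
  assumes "finite M" "inj_on g M" "(\<Sum>x\<in>M. Poly_Mapping.single (g x) (c x)) = 0" "x \<in> M"
  shows "c x = 0"
proof -
  have "0 = Poly_Mapping.lookup (\<Sum>y\<in>M. Poly_Mapping.single (g y) (c y)) (g x)"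
    using assms(3) by simp
  also have "\<dots> = (\<Sum>y\<in>M. if y = x then c y else 0)"
    unfolding lookup_sum
    by (intro sum.cong) (use assms(2,4) in \<open>auto simp: lookup_single when_def inj_on_eq_iff\<close>)
  also have "\<dots> = c x" using assms(1,4) by simp
  finally show ?thesis by simp
qed

text \<open>When translation respects the fibres of \<open>g\<close>, every translate of
  \<open>g\<close> factors through \<open>g\<close>. The kernel is then stable under multiplication
  by monomials, and so by all polynomials.\<close>

lemma submod_push_kernel:
  fixes g :: "'m::comm_monoid_add \<Rightarrow> 'z::comm_monoid_add"
  assumes "\<And>l m m'. g m = g m' \<Longrightarrow> g (l + m) = g (l + m')"
  shows "submod UNIV {f. push g f = 0}"
proof (rule submodI)
  fix s x assume "x \<in> {f. push g f = 0}"
  then have x: "push g x = 0" by simp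
  have "push (\<lambda>m. g (l + m)) x = 0" for l by (rule push_eq_0_factor[OF assms x])
  then have "push g (Poly_Mapping.single l c * x) = 0" for l c by (simp add: push_mult_single)
  then have "push g ((\<Sum>m\<in>Poly_Mapping.keys s. Poly_Mapping.single m (Poly_Mapping.lookup s m)) * x) = 0"
    by (simp add: sum_distrib_right push_sum)
  then show "s * x \<in> {f. push g f = 0}" by (simp add: sum_single)
qed (auto simp: push_add)

section \<open>Exponent vectors and toric maps\<close>

definition monomial :: "('v::finite \<Rightarrow> 'w) \<Rightarrow> ('v \<Rightarrow> nat) \<Rightarrow> 'w \<Rightarrow>\<^sub>0 nat" where
  "monomial \<iota> h = (\<Sum>v\<in>UNIV. Poly_Mapping.single (\<iota> v) (h v))"

text \<open>The degree sum of m_v a_v, written as a finitely supported function because exponents of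
  polynomials in t have that type.\<close>

definition multidegree :: "('v::finite \<Rightarrow> nat ^ 'n::finite) \<Rightarrow> ('v \<Rightarrow>\<^sub>0 nat) \<Rightarrow> 'n \<Rightarrow>\<^sub>0 nat" where
  "multidegree a m = monomial (\<lambda>i. i) (\<lambda>i. \<Sum>v\<in>UNIV. Poly_Mapping.lookup m v * a v $ i)"

lemma lookup_monomial:
  assumes "inj \<iota>"
  shows "Poly_Mapping.lookup (monomial \<iota> h) (\<iota> v) = h v"
  using assms by (simp add: monomial_def lookup_sum lookup_single when_def inj_eq)

lemma lookup_monomial_notin:
  "w \<notin> range \<iota> \<Longrightarrow> Poly_Mapping.lookup (monomial \<iota> h) w = 0"
  by (auto simp: monomial_def lookup_sum lookup_single when_def intro!: sum.neutral)

lemma lookup_multidegree: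
  "Poly_Mapping.lookup (multidegree a m) i = (\<Sum>v\<in>UNIV. Poly_Mapping.lookup m v * a v $ i)"
  using lookup_monomial[of "\<lambda>i. i"] by (simp add: multidegree_def inj_def)

lemma multidegree_add: "multidegree a (l + m) = multidegree a l + multidegree a m"
  by (rule poly_mapping_eqI) (simp add: lookup_multidegree lookup_add distrib_right sum.distrib)

lemma multidegree_zero [simp]: "multidegree a 0 = 0"
  by (rule poly_mapping_eqI) (simp add: lookup_multidegree)

lemma lookup_multidegree_single:
  "Poly_Mapping.lookup (multidegree a (Poly_Mapping.single v e)) i = e * a v $ i"
proof -
  have "(\<Sum>w\<in>UNIV. Poly_Mapping.lookup (Poly_Mapping.single v e) w * a w $ i) =
      (\<Sum>w\<in>UNIV. if w = v then e * a v $ i else 0)"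
    by (intro sum.cong) (auto simp: lookup_single when_def)
  then show ?thesis by (simp add: lookup_multidegree)
qed

lemma single_power:
  "Poly_Mapping.single x 1 ^ n = Poly_Mapping.single (\<Sum>_<n. x) (1 :: 'k::comm_ring_1)"
  for x :: "'m::comm_monoid_add"
  by (induction n) (simp_all add: mult_single add.commute)

lemma Var_power: "Var v ^ n = Poly_Mapping.single (Poly_Mapping.single v n) 1"
  by (induction n) (simp_all add: Var_def mult_single flip: single_add)

lemma prod_single:
  "(\<Prod>i\<in>I. Poly_Mapping.single (x i) 1) = Poly_Mapping.single (\<Sum>i\<in>I. x i) (1 :: 'k::comm_ring_1)"
  for x :: "'i \<Rightarrow> 'm::comm_monoid_add"
  by (induction I rule: infinite_finite_induct) (simp_all add: mult_single)

lemma prod_Var_power: "(\<Prod>v\<in>UNIV. Var (\<iota> v) ^ h v) = Poly_Mapping.single (monomial \<iota> h) 1"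
  by (simp add: Var_power prod_single monomial_def)

lemma prod_t_power:
  "(\<Prod>v\<in>UNIV. t_power (a v) ^ Poly_Mapping.lookup m v) = Poly_Mapping.single (multidegree a m) 1"
proof -
  have "(\<Prod>v\<in>UNIV. t_power (a v) ^ Poly_Mapping.lookup m v) =
      (\<Prod>v\<in>UNIV. \<Prod>i\<in>UNIV. (Var i ^ (Poly_Mapping.lookup m v * a v $ i)))"
    by (simp add: t_power_def prod_power_distrib mult.commute flip: power_mult)
  also have "\<dots> = (\<Prod>i\<in>UNIV. Var i ^ (\<Sum>v\<in>UNIV. Poly_Mapping.lookup m v * a v $ i))"
    by (subst prod.swap) (simp add: power_sum)
  also have "\<dots> = Poly_Mapping.single (multidegree a m) 1"
    unfolding multidegree_def by (rule prod_Var_power)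
  finally show ?thesis .
qed

lemma mpoly_subst_t_power: "mpoly_subst (\<lambda>v. t_power (a v)) = push (multidegree a)"
  by (rule ext) (simp add: mpoly_subst_def push_def prod_t_power Const_def mult_single)

lemma mpoly_subst_Var:
  "mpoly_subst (\<lambda>v. Var (\<iota> v)) = push (\<lambda>m. monomial \<iota> (Poly_Mapping.lookup m))"
  by (rule ext) (simp add: mpoly_subst_def push_def prod_Var_power Const_def mult_single)

lemma ring_of_type_algebra_eq: "ring_of_type_algebra = ring_on UNIV"
  by (simp add: ring_of_type_algebra_def ring_on_def)

lemma toric_ideal_eq: "toric_ideal a = {f. push (multidegree a) f = 0}"
  by (simp add: toric_ideal_def a_kernel_def kernel_def ring_of_type_algebra_eq mpoly_subst_t_power)

text \<open>The image of the toric map, spanned by the t^s with s in the semigroup: a copy of the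
  semigroup ring inside k[t].\<close>

definition monoid_algebra ::
    "'k::field itself \<Rightarrow> ('v::finite \<Rightarrow> nat ^ 'n::finite) \<Rightarrow> ('n, 'k) mpoly set" where
  "monoid_algebra _ a = range (push (multidegree a))"

definition generators ::
    "'k::field itself \<Rightarrow> ('v::finite \<Rightarrow> nat ^ 'n::finite) \<Rightarrow> ('n, 'k) mpoly set" where
  "generators _ a = range (\<lambda>v. t_power (a v))"

lemma push_multidegree_mult:
  "push (multidegree a) (f * g) = push (multidegree a) f * push (multidegree a) g"
  by (rule push_mult) (rule multidegree_add)

lemma push_multidegree_one [simp]: "push (multidegree a) 1 = 1"
  using push_single[of "multidegree a" 0 1] by simp

lemma comm_subring_monoid_algebra: "comm_subring (monoid_algebra K a)"
proof
  show "1 \<in> monoid_algebra K a"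
    unfolding monoid_algebra_def by (rule range_eqI[of _ _ 1]) simp
  fix x y assume "x \<in> monoid_algebra K a" "y \<in> monoid_algebra K a"
  then obtain f g where "x = push (multidegree a) f" "y = push (multidegree a) g"
    by (auto simp: monoid_algebra_def)
  then have "x - y = push (multidegree a) (f - g)" "x * y = push (multidegree a) (f * g)"
    by (simp_all add: push_diff push_multidegree_mult)
  then show "x - y \<in> monoid_algebra K a" "x * y \<in> monoid_algebra K a"
    by (auto simp: monoid_algebra_def)
qed

lemma single_multidegree_mem: "Poly_Mapping.single (multidegree a m) c \<in> monoid_algebra K a"
  unfolding monoid_algebra_def by (rule range_eqI[of _ _ "Poly_Mapping.single m c"]) simp

lemma t_power_eq: "t_power (a v) = Poly_Mapping.single (multidegree a (Poly_Mapping.single v 1)) 1"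
proof -
  have "monomial (\<lambda>i. i) (\<lambda>i. a v $ i) = multidegree a (Poly_Mapping.single v 1)"
  proof (rule poly_mapping_eqI)
    fix i
    show "Poly_Mapping.lookup (monomial (\<lambda>i. i) (\<lambda>i. a v $ i)) i =
        Poly_Mapping.lookup (multidegree a (Poly_Mapping.single v 1)) i"
      using lookup_monomial[of "\<lambda>i. i" "\<lambda>i. a v $ i" i]
      by (simp only: lookup_multidegree_single) simp
  qed
  then show ?thesis using prod_Var_power[of "\<lambda>i. i" "\<lambda>i. a v $ i"] by (simp add: t_power_def)
qed

lemma generators_subset: "generators K a \<subseteq> monoid_algebra K a"
  using single_multidegree_mem by (auto simp: generators_def t_power_eq)

text \<open>A nonzero ideal of a field contains 1. The constants are the base over which the basis
  theorem is iterated.\<close>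

lemma noetherian_constants:
  defines "S \<equiv> range (Const :: 'k::field \<Rightarrow> ('n, 'k) mpoly)"
  shows "comm_subring S" and "noetherian_over S S"
proof -
  have C: "Const (c - d) = Const c - (Const d :: ('n, 'k) mpoly)"
    "Const (c * d) = Const c * (Const d :: ('n, 'k) mpoly)"
    "Const 1 = (1 :: ('n, 'k) mpoly)" "Const 0 = (0 :: ('n, 'k) mpoly)" for c d :: 'k
    by (simp_all add: Const_def single_diff mult_single)
  show S: "comm_subring S"
  proof
    show "1 \<in> S" unfolding S_def by (rule range_eqI[of _ _ 1]) (simp add: C)
    fix x y assume "x \<in> S" "y \<in> S"
    then show "x - y \<in> S" "x * y \<in> S" by (auto simp: S_def simp flip: C)
  qed
  then interpret S: comm_subring S .
  show "noetherian_over S S"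
    unfolding noetherian_over_def
  proof (intro allI impI)
    fix N assume N: "submod S N" "N \<subseteq> S"
    show "\<exists>F. finite F \<and> F \<subseteq> N \<and> N = gen S F"
    proof (cases "N \<subseteq> {0}")
      case True
      then have "N = gen S {}" using submod_zero[OF N(1)] S.gen_empty by auto
      then show ?thesis by (intro exI[of _ "{}"]) auto
    next
      case False
      then obtain x where x: "x \<in> N" "x \<noteq> 0" by blast
      then obtain c where "x = Const c" using N(2) by (auto simp: S_def)
      with x have c: "Const c \<in> N" "c \<noteq> 0" using C(4) by auto
      have "Const (inverse c) * Const c \<in> N"
        by (rule submod_mult[OF N(1) _ c(1)]) (simp add: S_def)
      then have "1 \<in> N" using c(2) by (simp flip: C)
      then have "S \<subseteq> N" using submod_mult[OF N(1), of _ 1] by auto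
      moreover have "S \<subseteq> gen S {1}"
        using submod_mult[OF submod_gen _ gen_base, of _ S 1 "{1}"] by auto
      ultimately show ?thesis
        using N(2) \<open>1 \<in> N\<close> S.gen_in[of "{1}"] S.one_mem by (intro exI[of _ "{1}"]) auto
    qed
  qed
qed

text \<open>Minimality of \<open>T\<close> gives one inclusion; writing the toric map as a
  substitution of monomials gives the other.\<close>

lemma noetherian_monoid_algebra: "noetherian_over (monoid_algebra K a) (monoid_algebra K a)"
proof -
  let ?A = "monoid_algebra K a"
  let ?S = "range Const"
  interpret A: comm_subring ?A by (rule comm_subring_monoid_algebra)
  obtain T where T: "comm_subring T" "noetherian_over T T" "?S \<union> generators K a \<subseteq> T"
    "\<And>U. comm_subring U \<Longrightarrow> ?S \<union> generators K a \<subseteq> U \<Longrightarrow> T \<subseteq> U"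
    using comm_subring.noetherian_finitely_generated[OF noetherian_constants, of "generators K a"]
    by (auto simp: generators_def)
  interpret T: comm_subring T by fact
  have "?S \<subseteq> ?A" using single_multidegree_mem[of a 0] by (auto simp: Const_def)
  then have "T \<subseteq> ?A" using generators_subset by (intro T(4) A.comm_subring_axioms) auto
  moreover have "push (multidegree a) f \<in> T" for f
    unfolding mpoly_subst_t_power[symmetric] mpoly_subst_def
    using T(3) by (intro T.sum_mem T.mult_mem T.prod_mem T.power_mem) (auto simp: generators_def)
  then have "?A \<subseteq> T" by (auto simp: monoid_algebra_def)
  ultimately show ?thesis using T(2) by auto
qed

text \<open>As the generators are nonzero vectors, the elements of the ideal have zero constant
  term: exponents are natural numbers, so a product has a nonzero constant term only if both factors
  do.\<close>

lemma homogeneous_ideal_proper: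
  assumes "\<And>v. a v \<noteq> 0"
  shows "1 \<notin> gen (monoid_algebra K a) (generators K a)"
proof -
  let ?A = "monoid_algebra K a"
  interpret A: comm_subring ?A by (rule comm_subring_monoid_algebra)
  let ?N = "{f. Poly_Mapping.lookup f 0 = 0}"
  have "gen ?A (generators K a) \<subseteq> ?N"
  proof (rule gen_least)
    show "submod ?A ?N"
    proof (rule submodI)
      fix s x :: "('b, 'c) mpoly" assume "x \<in> ?N"
      then have x: "0 \<notin> Poly_Mapping.keys x" by (simp add: in_keys_iff)
      have "0 \<notin> Poly_Mapping.keys (s * x)"
      proof
        assume "0 \<in> Poly_Mapping.keys (s * x)"
        then obtain l m where lm: "m \<in> Poly_Mapping.keys x" "0 = l + m" using keys_mult by blast
        then have "Poly_Mapping.lookup l i + Poly_Mapping.lookup m i = 0" for i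
          by (metis lookup_add lookup_zero)
        then have "m = 0" by (intro poly_mapping_eqI) simp
        with lm(1) x show False by simp
      qed
      then show "s * x \<in> ?N" by (simp add: in_keys_iff)
    qed (auto simp: lookup_add)
    show "generators K a \<subseteq> ?N"
    proof
      fix x assume "x \<in> generators K a"
      then obtain v where v: "x = Poly_Mapping.single (multidegree a (Poly_Mapping.single v 1)) 1"
        by (auto simp: generators_def t_power_eq)
      obtain i where "a v $ i \<noteq> 0" using assms[of v] by (metis vec_eq_iff zero_index)
      then have "multidegree a (Poly_Mapping.single v 1) \<noteq> 0"
        using lookup_multidegree_single[of a v 1 i] by auto
      then show "x \<in> ?N" by (simp add: v lookup_single when_def)
    qed
  qed
  then show ?thesis by auto
qed

text \<open>The first isomorphism theorem for the toric map. The class of the variable v goes to the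
  monomial with exponent a_v, so the homogeneous maximal ideal is carried to the ideal of the
  \<open>generators\<close>.\<close>

lemma
  fixes K :: "'k::field itself" and a :: "'v::finite \<Rightarrow> nat ^ 'n::finite"
  shows krull_dim_semigroup_ring: "krull_dim (semigroup_ring K a) = chain_dim (monoid_algebra K a)"
    and depth_semigroup_ring: "(\<And>v. a v \<noteq> 0) \<Longrightarrow>
      depth (semigroup_ring K a) (homogeneous_maximal_ideal K a) =
      seq_depth (monoid_algebra K a) (gen (monoid_algebra K a) (generators K a))"
proof -
  let ?A = "monoid_algebra K a" and ?\<phi> = "push (multidegree a) :: ('v, 'k) mpoly \<Rightarrow> ('n, 'k) mpoly"
  let ?R = "mpoly_ring :: ('v, 'k) mpoly ring"
  interpret A: comm_subring ?A by (rule comm_subring_monoid_algebra)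
  have R: "cring ?R" by (rule cring_from_type_algebra)
  have carrier: "carrier ?R = UNIV" by (simp add: ring_of_type_algebra_eq)
  have image: "?\<phi> ` carrier ?R = carrier (ring_on ?A)" by (simp add: carrier monoid_algebra_def)
  have ker: "a_kernel ?R (ring_on ?A) ?\<phi> = toric_ideal a"
    by (simp add: toric_ideal_eq a_kernel_def kernel_def ring_of_type_algebra_eq)
  have "?\<phi> \<in> ring_hom ?R (ring_on ?A)"
    by (rule ring_hom_memI)
      (auto simp: ring_of_type_algebra_eq monoid_algebra_def push_add push_multidegree_mult)
  then interpret hom: ring_hom_ring ?R "ring_on ?A" ?\<phi>
    by (rule ring_hom_ringI2[OF cring.axioms(1)[OF R] A.ring_ring_on])
  define h where "h = (\<lambda>Y. the_elem (?\<phi> ` Y))"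
  have h: "h \<in> ring_iso (semigroup_ring K a) (ring_on ?A)"
    unfolding h_def semigroup_ring_def ker[symmetric]
    by (rule hom.FactRing_iso_set[OF image])
  have ideal: "ideal (toric_ideal a) ?R"
    unfolding ker[symmetric] by (rule hom.kernel_is_ideal)
  have Q: "cring (semigroup_ring K a)"
    unfolding semigroup_ring_def by (rule ideal.quotient_is_cring[OF ideal R])
  show "krull_dim (semigroup_ring K a) = chain_dim ?A"
    unfolding krull_dim_iso[OF Q A.cring_ring_on h] by (rule A.krull_dim_ring_on)
  define G where "G = range (\<lambda>v. toric_ideal a +>\<^bsub>?R\<^esub> Var v)"
  have G: "G \<subseteq> carrier (semigroup_ring K a)"
  proof -
    have "toric_ideal a +>\<^bsub>?R\<^esub> Var v \<in> a_rcosets\<^bsub>?R\<^esub> (toric_ideal a)" for v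
      by (rule hom.R.a_rcosetsI) (simp_all only: carrier subset_UNIV UNIV_I)
    then show ?thesis
      unfolding G_def semigroup_ring_def FactRing_def partial_object.simps by blast
  qed
  have "h (toric_ideal a +>\<^bsub>?R\<^esub> Var v) = t_power (a v)" for v
    unfolding h_def ker[symmetric] t_power_eq
    by (subst hom.the_elem_simp) (simp_all only: carrier UNIV_I Var_def push_single)
  then have hG: "h ` G = generators K a" by (simp add: G_def generators_def image_image)
  interpret Q: cring "semigroup_ring K a" by (rule Q)
  assume "\<And>v. a v \<noteq> 0"
  then have "1 \<notin> gen ?A (generators K a)" by (rule homogeneous_ideal_proper)
  moreover have "homogeneous_maximal_ideal K a \<subseteq> carrier (semigroup_ring K a)"
    using Q.genideal_ideal[OF G]
    by (simp add: homogeneous_maximal_ideal_def G_def additive_subgroup.a_subset ideal.axioms(1))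
  moreover have "h ` homogeneous_maximal_ideal K a = gen ?A (generators K a)"
    unfolding homogeneous_maximal_ideal_def G_def[symmetric] iso_genideal[OF Q A.cring_ring_on h G] hG
    by (rule A.genideal_ring_on[OF generators_subset])
  ultimately show "depth (semigroup_ring K a) (homogeneous_maximal_ideal K a) =
      seq_depth ?A (gen ?A (generators K a))"
    by (simp only: depth_iso[OF Q A.cring_ring_on h] simp_thms
        A.depth_ring_on[OF submod_gen A.gen_in[OF generators_subset]])
qed

section \<open>Gluing with a semigroup on a line\<close>

lemma sum_UNIV_sum: "(\<Sum>x\<in>UNIV. f x) = (\<Sum>i\<in>UNIV. f (Inl i)) + (\<Sum>j\<in>UNIV. f (Inr j))"
  for f :: "'p::finite + 'q::finite \<Rightarrow> 'c::comm_monoid_add"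
  using sum.Plus[of "UNIV :: 'p set" "UNIV :: 'q set" f] by simp

lemma set_add_ring_on: "I <+>\<^bsub>ring_on S\<^esub> J = {x + y | x y. x \<in> I \<and> y \<in> J}"
  by (auto simp: set_add_defs)

lemma set_add_ring_onI: "x \<in> I \<Longrightarrow> y \<in> J \<Longrightarrow> x + y \<in> I <+>\<^bsub>ring_on S\<^esub> J"
  by (auto simp: set_add_ring_on)

locale gluing_on_line =
  fixes K :: "'k::field itself" and a :: "'p::finite \<Rightarrow> nat ^ 'n::finite" and b :: "'q::finite \<Rightarrow> nat ^ 'n"
    and k1 k2 :: nat and \<alpha> :: "nat ^ 'p" and \<beta> :: "nat ^ 'q" and u :: "'q \<Rightarrow> nat" and v :: "nat ^ 'n"
  assumes k_pos: "0 < k1" "0 < k2"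
    and a_nonzero: "\<And>i. a i \<noteq> 0" and b_nonzero: "\<And>j. b j \<noteq> 0"
    and line: "\<And>j. b j = u j *s v"
    and binomial_nonzero: "gluing_binomial \<alpha> \<beta> \<noteq> (0 :: ('p + 'q, 'k) mpoly)"
    and toric_ideal_gluing: "toric_ideal (glued_family k1 k2 a b) =
          Idl\<^bsub>ring_on UNIV\<^esub> (mpoly_subst (\<lambda>i. Var (Inl i)) ` (toric_ideal a :: ('p, 'k) mpoly set)) <+>\<^bsub>ring_on UNIV\<^esub>
          Idl\<^bsub>ring_on UNIV\<^esub> (mpoly_subst (\<lambda>j. Var (Inr j)) ` (toric_ideal b :: ('q, 'k) mpoly set)) <+>\<^bsub>ring_on UNIV\<^esub>
          Idl\<^bsub>ring_on UNIV\<^esub> {gluing_binomial \<alpha> \<beta> :: ('p + 'q, 'k) mpoly}"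
begin

definition "c = glued_family k1 k2 a b"

text \<open>Scaling by k_1 leaves the toric ideal unchanged and places the copy of k[A] inside that
  of k[C].\<close>

definition "a' = (\<lambda>i. k1 *s a i)"

definition degA :: "('p + 'q \<Rightarrow>\<^sub>0 nat) \<Rightarrow> 'n \<Rightarrow> nat" where
  "degA m i = (\<Sum>p\<in>UNIV. Poly_Mapping.lookup m (Inl p) * a p $ i)"

definition degB :: "('p + 'q \<Rightarrow>\<^sub>0 nat) \<Rightarrow> nat" where
  "degB m = (\<Sum>q\<in>UNIV. Poly_Mapping.lookup m (Inr q) * u q)"

text \<open>Together with \<open>w\<close> this records the degrees of the binomial: x^\<alpha> has
  (\<open>degA\<close>, \<open>degB\<close>) = (\<gamma>, 0) and y^\<beta> has (0, w).\<close>

definition \<gamma> :: "'n \<Rightarrow> nat" where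
  "\<gamma> i = (\<Sum>p\<in>UNIV. \<alpha> $ p * a p $ i)"

definition w :: nat where
  "w = (\<Sum>q\<in>UNIV. \<beta> $ q * u q)"

text \<open>\<open>\<Psi>\<close> separates the classes of the group \<open>\<int>\<^sup>n \<times> \<int> / (\<gamma>, - w)\<close>, in which the degrees of the two
  terms of the gluing binomial agree.\<close>

definition \<Psi> :: "('p + 'q \<Rightarrow>\<^sub>0 nat) \<Rightarrow> (nat ^ 'n) \<times> nat" where
  "\<Psi> m = ((\<chi> i. w * degA m i + degB m * \<gamma> i), degB m mod w)"

definition pair :: "('p \<Rightarrow> nat) \<Rightarrow> ('q \<Rightarrow> nat) \<Rightarrow> 'p + 'q \<Rightarrow>\<^sub>0 nat" where
  "pair h g = monomial Inl h + monomial Inr g"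

lemma lookup_pair [simp]:
  "Poly_Mapping.lookup (pair h g) (Inl p) = h p"
  "Poly_Mapping.lookup (pair h g) (Inr q) = g q"
  by (simp_all add: pair_def lookup_add lookup_monomial lookup_monomial_notin image_iff)

lemma degA_add: "degA (l + m) i = degA l i + degA m i"
  by (simp add: degA_def lookup_add distrib_right sum.distrib)

lemma degB_add: "degB (l + m) = degB l + degB m"
  by (simp add: degB_def lookup_add distrib_right sum.distrib)

lemma \<Psi>_eq_iff: "\<Psi> m = \<Psi> m' \<longleftrightarrow>
    (\<forall>i. w * degA m i + degB m * \<gamma> i = w * degA m' i + degB m' * \<gamma> i) \<and> degB m mod w = degB m' mod w"
  by (auto simp: \<Psi>_def vec_eq_iff)

lemma \<Psi>_congruence: "\<Psi> m = \<Psi> m' \<Longrightarrow> \<Psi> (l + m) = \<Psi> (l + m')"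
  unfolding \<Psi>_eq_iff by (auto simp: degA_add degB_add algebra_simps intro: mod_add_cong)

lemma multidegree_c: "Poly_Mapping.lookup (multidegree c m) i = k1 * degA m i + k2 * degB m * v $ i"
  by (simp add: lookup_multidegree sum_UNIV_sum c_def glued_family_def line degA_def degB_def
      sum_distrib_left sum_distrib_right algebra_simps)

lemma multidegree_a': "Poly_Mapping.lookup (multidegree a' m) i =
    k1 * (\<Sum>p\<in>UNIV. Poly_Mapping.lookup m p * a p $ i)"
  by (simp add: lookup_multidegree a'_def sum_distrib_left algebra_simps)

lemma gluing_binomial_eq: "gluing_binomial \<alpha> \<beta> =
    Poly_Mapping.single (monomial Inl (($) \<alpha>)) 1 - Poly_Mapping.single (monomial Inr (($) \<beta>)) 1"
  by (simp add: gluing_binomial_def prod_Var_power)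

lemma u_pos: "0 < u j" and v_nonzero: "v \<noteq> 0"
  using b_nonzero[of j] line[of j] by (auto simp: vec_eq_iff)

lemma degA_alpha: "degA (monomial Inl (($) \<alpha>)) i = \<gamma> i" "degB (monomial Inl (($) \<alpha>)) = 0"
  by (simp_all add: degA_def degB_def \<gamma>_def lookup_monomial lookup_monomial_notin image_iff)

lemma degA_beta: "degA (monomial Inr (($) \<beta>)) i = 0" "degB (monomial Inr (($) \<beta>)) = w"
  by (simp_all add: degA_def degB_def w_def lookup_monomial lookup_monomial_notin image_iff)

text \<open>Each of the three summands of I_C is killed: on monomials purely in x or purely in y the
  value of \<Psi> depends only on the degree for \<open>a\<close> or for \<open>b\<close>, and
  \<Psi> takes equal values on the two terms of the binomial.\<close>

lemma subset_kernel_\<Psi>: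
  "(toric_ideal c :: ('p + 'q, 'k) mpoly set) \<subseteq> {f. push \<Psi> f = 0}" (is "_ \<subseteq> ?N")
proof -
  interpret U: comm_subring "UNIV :: ('p + 'q, 'k) mpoly set" by standard auto
  have N: "submod UNIV ?N" by (rule submod_push_kernel) (rule \<Psi>_congruence)
  have Idl: "Idl\<^bsub>ring_on UNIV\<^esub> B \<subseteq> ?N" if "B \<subseteq> ?N" for B
    using U.genideal_ring_on[of B] gen_least[OF N that] by simp
  have A: "mpoly_subst (\<lambda>i. Var (Inl i)) ` (toric_ideal a :: ('p, 'k) mpoly set) \<subseteq> ?N"
  proof safe
    fix f :: "('p, 'k) mpoly" assume "f \<in> toric_ideal a"
    then have f: "push (multidegree a) f = 0" by (simp add: toric_ideal_eq)
    have "push (\<lambda>m. \<Psi> (monomial Inl (Poly_Mapping.lookup m))) f = 0"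
    proof (rule push_eq_0_factor[OF _ f])
      fix m m' assume "multidegree a m = multidegree a m'"
      then have "(\<Sum>p\<in>UNIV. Poly_Mapping.lookup m p * a p $ i) =
          (\<Sum>p\<in>UNIV. Poly_Mapping.lookup m' p * a p $ i)" for i
        by (metis lookup_multidegree)
      then show "\<Psi> (monomial Inl (Poly_Mapping.lookup m)) = \<Psi> (monomial Inl (Poly_Mapping.lookup m'))"
        by (simp add: \<Psi>_eq_iff degA_def degB_def lookup_monomial lookup_monomial_notin image_iff)
    qed
    then show "push \<Psi> (mpoly_subst (\<lambda>i. Var (Inl i)) f) = 0" by (simp add: mpoly_subst_Var push_push)
  qed
  have B: "mpoly_subst (\<lambda>j. Var (Inr j)) ` (toric_ideal b :: ('q, 'k) mpoly set) \<subseteq> ?N"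
  proof safe
    fix f :: "('q, 'k) mpoly" assume "f \<in> toric_ideal b"
    then have f: "push (multidegree b) f = 0" by (simp add: toric_ideal_eq)
    have "push (\<lambda>m. \<Psi> (monomial Inr (Poly_Mapping.lookup m))) f = 0"
    proof (rule push_eq_0_factor[OF _ f])
      fix m m' assume eq: "multidegree b m = multidegree b m'"
      \<comment> \<open>A nonzero coordinate of \<open>v\<close> recovers \<open>degB\<close> from
        the degree along the line.\<close>
      obtain i where i: "v $ i \<noteq> 0" using v_nonzero by (metis vec_eq_iff zero_index)
      have "Poly_Mapping.lookup (multidegree b m) i =
          (\<Sum>q\<in>UNIV. Poly_Mapping.lookup m q * u q) * v $ i" for m
        by (simp add: lookup_multidegree line sum_distrib_right mult.assoc)
      then have "(\<Sum>q\<in>UNIV. Poly_Mapping.lookup m q * u q) = (\<Sum>q\<in>UNIV. Poly_Mapping.lookup m' q * u q)"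
        using eq i by (metis mult_cancel2)
      then show "\<Psi> (monomial Inr (Poly_Mapping.lookup m)) = \<Psi> (monomial Inr (Poly_Mapping.lookup m'))"
        by (simp add: \<Psi>_eq_iff degA_def degB_def lookup_monomial lookup_monomial_notin image_iff)
    qed
    then show "push \<Psi> (mpoly_subst (\<lambda>j. Var (Inr j)) f) = 0" by (simp add: mpoly_subst_Var push_push)
  qed
  have "\<Psi> (monomial Inl (($) \<alpha>)) = \<Psi> (monomial Inr (($) \<beta>))"
    by (simp add: \<Psi>_eq_iff degA_alpha degA_beta)
  then have rho: "{gluing_binomial \<alpha> \<beta> :: ('p + 'q, 'k) mpoly} \<subseteq> ?N"
    by (simp add: gluing_binomial_eq push_diff)
  have add: "I <+>\<^bsub>ring_on UNIV\<^esub> J \<subseteq> ?N" if "I \<subseteq> ?N" "J \<subseteq> ?N" for I J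
    using that submod_add[OF N] unfolding set_add_ring_on by blast
  show ?thesis
    unfolding c_def toric_ideal_gluing by (intro add Idl A B rho)
qed

text \<open>The difference of the two monomials lies in I_C, so \<Psi> cannot separate them. For
  positive w this means that the pairs (\<open>degA\<close>, \<open>degB\<close>) differ by a
  multiple of (\<gamma>, -w).\<close>

lemma multidegree_c_eq_imp:
  assumes "multidegree c m = multidegree c m'"
  shows "\<Psi> m = \<Psi> m'"
proof -
  have "(Poly_Mapping.single m 1 - Poly_Mapping.single m' 1 :: ('p + 'q, 'k) mpoly) \<in> toric_ideal c"
    using assms by (simp add: toric_ideal_eq push_diff)
  then have "Poly_Mapping.single (\<Psi> m) (1 :: 'k) = Poly_Mapping.single (\<Psi> m') 1"
    using subset_kernel_\<Psi> by (auto simp: push_diff)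
  then have "Poly_Mapping.keys (Poly_Mapping.single (\<Psi> m) (1 :: 'k)) =
      Poly_Mapping.keys (Poly_Mapping.single (\<Psi> m') (1 :: 'k))" by simp
  then show ?thesis by simp
qed

text \<open>The binomial itself is in I_C, as one of the summands is generated by it, so its two
  monomials have the same degree for \<open>c\<close>.\<close>

lemma binomial_relation: "k1 * \<gamma> i = k2 * w * v $ i"
proof -
  interpret U: comm_subring "UNIV :: ('p + 'q, 'k) mpoly set" by standard auto
  have Idl: "Idl\<^bsub>ring_on UNIV\<^esub> B = gen UNIV B" for B :: "('p + 'q, 'k) mpoly set"
    by (rule U.genideal_ring_on) simp
  have "((0 + 0) + gluing_binomial \<alpha> \<beta> :: ('p + 'q, 'k) mpoly) \<in> toric_ideal c"
    unfolding c_def toric_ideal_gluing Idl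
    by (intro set_add_ring_onI gen_zero gen_base) simp
  then have "Poly_Mapping.single (multidegree c (monomial Inl (($) \<alpha>))) (1 :: 'k) =
      Poly_Mapping.single (multidegree c (monomial Inr (($) \<beta>))) 1"
    by (simp add: toric_ideal_eq gluing_binomial_eq push_diff)
  then have "Poly_Mapping.keys (Poly_Mapping.single (multidegree c (monomial Inl (($) \<alpha>))) (1 :: 'k)) =
      Poly_Mapping.keys (Poly_Mapping.single (multidegree c (monomial Inr (($) \<beta>))) (1 :: 'k))" by simp
  then have "multidegree c (monomial Inl (($) \<alpha>)) = multidegree c (monomial Inr (($) \<beta>))" by simp
  then have "Poly_Mapping.lookup (multidegree c (monomial Inl (($) \<alpha>))) i =
      Poly_Mapping.lookup (multidegree c (monomial Inr (($) \<beta>))) i" by simp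
  then show ?thesis by (simp add: multidegree_c degA_alpha degA_beta)
qed

text \<open>If w were 0, positivity of the u_j would give \<beta> = 0. The degree relation would
  give \<gamma> = 0, hence \<alpha> = 0 as the a_i are nonzero, and the binomial would be 1 -
  1.\<close>

lemma w_pos: "0 < w"
proof (rule ccontr)
  assume "\<not> ?thesis"
  then have w: "w = 0" by simp
  then have "\<forall>j. \<beta> $ j = 0 \<or> u j = 0" by (simp add: w_def)
  then have "\<beta> $ j = 0" for j using u_pos[of j] by (metis less_irrefl)
  then have \<beta>: "\<beta> = 0" by (simp add: vec_eq_iff)
  have "\<gamma> i = 0" for i using binomial_relation[of i] k_pos w by simp
  then have "\<alpha> $ p = 0 \<or> a p $ i = 0" for p i by (auto simp: \<gamma>_def)
  then have "\<alpha> = 0" using a_nonzero by (metis vec_eq_iff zero_index)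
  with \<beta> show False using binomial_nonzero by (simp add: gluing_binomial_def)
qed

lemma alpha_nonzero: "\<exists>p. \<alpha> $ p \<noteq> 0"
proof (rule ccontr)
  assume "\<not> ?thesis"
  then have "\<gamma> i = 0" for i by (simp add: \<gamma>_def)
  then have "v $ i = 0" for i using binomial_relation[of i] k_pos w_pos by simp
  then show False using v_nonzero by (simp add: vec_eq_iff)
qed

section \<open>The semigroup generated by the u_j and its Apery set\<close>

definition semigroupB :: "nat set" where
  "semigroupB = range degB"

text \<open>The condition that d - w lies outside the semigroup is phrased additively, to avoid
  truncated subtraction when d < w.\<close>

definition apery :: "nat set" where
  "apery = {d \<in> semigroupB. \<forall>d'\<in>semigroupB. d \<noteq> d' + w}"

definition shift :: "nat \<Rightarrow> 'n \<Rightarrow>\<^sub>0 nat" where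
  "shift d = monomial (\<lambda>i. i) (\<lambda>i. k2 * d * v $ i)"

lemma lookup_shift: "Poly_Mapping.lookup (shift d) i = k2 * d * v $ i"
  using lookup_monomial[of "\<lambda>i. i"] by (simp add: shift_def)

lemma semigroupB_add: "d \<in> semigroupB \<Longrightarrow> d' \<in> semigroupB \<Longrightarrow> d + d' \<in> semigroupB"
  by (auto simp: semigroupB_def simp flip: degB_add)

lemma w_mem: "w \<in> semigroupB"
  using rangeI[of degB "monomial Inr (($) \<beta>)"] by (simp add: semigroupB_def degA_beta)

lemma semigroupB_mult_w: "d \<in> semigroupB \<Longrightarrow> d + r * w \<in> semigroupB"
proof (induction r)
  case (Suc r)
  then have "w + (d + r * w) \<in> semigroupB" using semigroupB_add w_mem by blast
  then show ?case by (simp add: ac_simps)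
qed simp

text \<open>Subtracting w as long as the result stays in the semigroup stops after finitely many
  steps because w > 0.\<close>

lemma apery_decomposition: "d \<in> semigroupB \<Longrightarrow> \<exists>d0\<in>apery. \<exists>r. d = d0 + r * w"
proof (induction d rule: less_induct)
  case (less d)
  show ?case
  proof (cases "d \<in> apery")
    case True
    then show ?thesis by (intro bexI[of _ d] exI[of _ 0]) auto
  next
    case False
    then obtain d' where d': "d' \<in> semigroupB" "d = d' + w" using less.prems by (auto simp: apery_def)
    then obtain d0 r where "d0 \<in> apery" "d' = d0 + r * w" using less.IH[of d'] w_pos by auto
    then show ?thesis using d' by (intro bexI[of _ d0] exI[of _ "Suc r"]) auto
  qed
qed

text \<open>Of two distinct congruent elements the larger minus w is the smaller plus a multiple of
  w, hence in the semigroup, so the larger is not in the Apery set.\<close>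

lemma apery_mod_eq:
  assumes "d \<in> apery" "d' \<in> apery" "d mod w = d' mod w"
  shows "d = d'"
proof -
  have False if xy: "x \<in> apery" "y \<in> apery" "x mod w = y mod w" "x < y" for x y
  proof -
    obtain r where "y = x + w * r"
      using mod_eq_nat2E[OF xy(3) less_imp_le[OF xy(4)]] .
    then have r: "y = x + r * w" by (simp add: mult.commute)
    then obtain s where "r = Suc s" using \<open>x < y\<close> by (cases r) auto
    then have "y = (x + s * w) + w" using r by simp
    moreover have "x + s * w \<in> semigroupB" using xy by (intro semigroupB_mult_w) (auto simp: apery_def)
    ultimately show False using xy by (auto simp: apery_def)
  qed
  then show ?thesis using assms by (metis linorder_neqE_nat)
qed

lemma finite_apery: "finite apery"
proof (rule inj_on_finite)
  show "inj_on (\<lambda>d. d mod w) apery" using apery_mod_eq by (auto intro: inj_onI)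
  show "(\<lambda>d. d mod w) ` apery \<subseteq> {..<w}" using w_pos by auto
qed simp

text \<open>\<open>degB\<close> reads only the exponents of y, so one \<open>g\<close> works for
  every x part.\<close>

lemma semigroupB_pair: "d \<in> semigroupB \<Longrightarrow> \<exists>g. \<forall>h. degB (pair h g) = d"
  by (auto simp: semigroupB_def degB_def)

lemma multidegree_pair:
  "multidegree c (pair (Poly_Mapping.lookup m) g) = multidegree a' m + shift (degB (pair h g))"
  by (rule poly_mapping_eqI)
    (simp add: multidegree_c multidegree_a' lookup_add lookup_shift degA_def degB_def)

text \<open>Both sides are lifted to monomials of equal degree for \<open>c\<close>, where the
  residue component of \<Psi> identifies the Apery elements; the rest is cancellation.\<close>

lemma unique_representation:
  assumes "d \<in> apery" "d' \<in> apery" "multidegree a' m + shift d = multidegree a' m' + shift d'"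
  shows "d = d'" "multidegree a' m = multidegree a' m'"
proof -
  have "d \<in> semigroupB" "d' \<in> semigroupB" using assms by (auto simp: apery_def)
  then obtain g g' where g: "\<forall>h. degB (pair h g) = d" and g': "\<forall>h. degB (pair h g') = d'"
    using semigroupB_pair by metis
  have "multidegree c (pair (Poly_Mapping.lookup m) g) = multidegree c (pair (Poly_Mapping.lookup m') g')"
    using multidegree_pair g g' assms(3) by metis
  then have "\<Psi> (pair (Poly_Mapping.lookup m) g) = \<Psi> (pair (Poly_Mapping.lookup m') g')"
    by (rule multidegree_c_eq_imp)
  then show "d = d'" using apery_mod_eq[OF assms(1,2)] g g' by (simp add: \<Psi>_eq_iff)
  then show "multidegree a' m = multidegree a' m'" using assms(3) by simp
qed

section \<open>The free module structure of k[C] over k[A]\<close>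

abbreviation "kA \<equiv> monoid_algebra K a'"
abbreviation "kC \<equiv> monoid_algebra K c"

lemma kA_subset: "kA \<subseteq> kC"
proof -
  have eq: "multidegree c (monomial Inl (Poly_Mapping.lookup m)) = multidegree a' m" for m
    by (rule poly_mapping_eqI)
      (simp add: multidegree_c multidegree_a' degA_def degB_def lookup_monomial lookup_monomial_notin image_iff)
  have "push (multidegree a') f =
      push (multidegree c) (push (\<lambda>m. monomial Inl (Poly_Mapping.lookup m)) f)" for f :: "('p, 'k) mpoly"
    by (simp add: push_push eq)
  then show ?thesis by (auto simp: monoid_algebra_def)
qed

lemma shift_mem: "d \<in> semigroupB \<Longrightarrow> Poly_Mapping.single (shift d) 1 \<in> kC"
proof -
  assume "d \<in> semigroupB"
  then obtain g where g: "degB (pair (\<lambda>_. 0) g) = d" using semigroupB_pair by blast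
  have "multidegree c (pair (Poly_Mapping.lookup 0) g) = shift d"
    using multidegree_pair[of 0 g "\<lambda>_. 0"] g by simp
  then show ?thesis using single_multidegree_mem by metis
qed

lemma spanning:
  assumes "x \<in> kC"
  shows "\<exists>f. (\<forall>d\<in>apery. f d \<in> kA) \<and> x = (\<Sum>d\<in>apery. f d * Poly_Mapping.single (shift d) 1)"
proof -
  interpret A: comm_subring kA by (rule comm_subring_monoid_algebra)
  let ?N = "{\<Sum>d\<in>apery. f d * Poly_Mapping.single (shift d) 1 | f. \<forall>d\<in>apery. f d \<in> kA}"
  \<comment> \<open>With no scalars \<open>submod\<close> means closure under finite sums, so it
    suffices to treat single terms.\<close>
  have N: "submod {} ?N"
  proof (rule submodI)
    show "0 \<in> ?N" by (intro CollectI exI[of _ "\<lambda>_. 0"]) (auto simp: A.zero_mem)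
    fix y z assume "y \<in> ?N" "z \<in> ?N"
    then obtain f g where "\<forall>d\<in>apery. f d \<in> kA" "y = (\<Sum>d\<in>apery. f d * Poly_Mapping.single (shift d) 1)"
      "\<forall>d\<in>apery. g d \<in> kA" "z = (\<Sum>d\<in>apery. g d * Poly_Mapping.single (shift d) 1)" by blast
    then show "y + z \<in> ?N"
      by (intro CollectI exI[of _ "\<lambda>d. f d + g d"]) (auto simp: distrib_right sum.distrib A.add_mem)
  qed auto
  have single: "Poly_Mapping.single (multidegree c m) y \<in> ?N" for m :: "'p + 'q \<Rightarrow>\<^sub>0 nat" and y :: 'k
  proof -
    obtain d0 r where d0: "d0 \<in> apery" "degB m = d0 + r * w"
      using apery_decomposition[of "degB m"] by (auto simp: semigroupB_def)
    \<comment> \<open>The r copies of w in \<open>degB m\<close> are traded for the monomial x^(r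
      \<alpha>), which has the same degree by \<open>binomial_relation\<close>.\<close>
    define l where "l = monomial (\<lambda>p. p) (\<lambda>p. Poly_Mapping.lookup m (Inl p) + r * \<alpha> $ p)"
    have l: "Poly_Mapping.lookup l p = Poly_Mapping.lookup m (Inl p) + r * \<alpha> $ p" for p
      using lookup_monomial[of "\<lambda>p. p"] by (simp add: l_def)
    have "multidegree c m = multidegree a' l + shift d0"
    proof (rule poly_mapping_eqI)
      fix i
      have "(\<Sum>p\<in>UNIV. Poly_Mapping.lookup l p * a p $ i) = degA m i + r * \<gamma> i"
        by (simp add: l degA_def \<gamma>_def distrib_right sum.distrib sum_distrib_left mult.assoc)
      then show "Poly_Mapping.lookup (multidegree c m) i =
          Poly_Mapping.lookup (multidegree a' l + shift d0) i"
        using binomial_relation[of i]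
        by (simp add: multidegree_c multidegree_a' lookup_add lookup_shift d0 algebra_simps)
    qed
    then have "Poly_Mapping.single (multidegree c m) y =
        Poly_Mapping.single (multidegree a' l) y * Poly_Mapping.single (shift d0) 1"
      by (simp add: mult_single)
    also have "\<dots> = (\<Sum>d\<in>apery. (if d = d0 then Poly_Mapping.single (multidegree a' l) y else 0) *
        Poly_Mapping.single (shift d) 1)"
    proof -
      have "(\<Sum>d\<in>apery. (if d = d0 then Poly_Mapping.single (multidegree a' l) y else 0) *
        Poly_Mapping.single (shift d) 1) = (\<Sum>d\<in>apery. if d = d0 then
          Poly_Mapping.single (multidegree a' l) y * Poly_Mapping.single (shift d) 1 else 0)"
        by (intro sum.cong) auto
      then show ?thesis using finite_apery d0 by simp
    qed
    finally show ?thesis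
      by (intro CollectI exI[of _ "\<lambda>d. if d = d0 then Poly_Mapping.single (multidegree a' l) y else 0"])
        (auto simp: A.zero_mem single_multidegree_mem)
  qed
  from assms obtain f where "x = push (multidegree c) f" by (auto simp: monoid_algebra_def)
  then have "x \<in> ?N" unfolding push_def by (simp only:) (rule submod_sum[OF N single])
  then show ?thesis by blast
qed

text \<open>By \<open>unique_representation\<close> the exponents s + \<open>shift d\<close> are
  pairwise distinct over all d in the Apery set and all s in the support of \<open>f d\<close>, so
  no terms can cancel.\<close>

lemma independent:
  assumes f: "\<And>d. d \<in> apery \<Longrightarrow> f d \<in> kA"
    and zero: "(\<Sum>d\<in>apery. f d * Poly_Mapping.single (shift d) 1) = 0" and d: "d \<in> apery"
  shows "f d = 0"
proof -
  let ?M = "Sigma apery (\<lambda>d. Poly_Mapping.keys (f d))"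
  \<comment> \<open>Uniqueness speaks only of exponents that are degrees for \<open>a'\<close>;
    those in the support of an element of \<open>kA\<close> are of this kind.\<close>
  have keys: "\<exists>m. s = multidegree a' m" if ds: "d \<in> apery" "s \<in> Poly_Mapping.keys (f d)" for d s
  proof -
    obtain g where g: "f d = push (multidegree a') g" using f[OF ds(1)] by (auto simp: monoid_algebra_def)
    show ?thesis
    proof (rule ccontr)
      assume "\<not> ?thesis"
      then have "Poly_Mapping.lookup (f d) s = 0"
        unfolding g push_def lookup_sum by (intro sum.neutral) (auto simp: lookup_single when_def)
      with ds show False by (simp add: in_keys_iff)
    qed
  qed
  have fd: "f d * Poly_Mapping.single (shift d) 1 = (\<Sum>s\<in>Poly_Mapping.keys (f d).
      Poly_Mapping.single (s + shift d) (Poly_Mapping.lookup (f d) s))" for d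
    using arg_cong[OF sum_single[of "f d"], of "\<lambda>x. x * Poly_Mapping.single (shift d) 1"]
    by (simp add: sum_distrib_right mult_single)
  have "(\<Sum>(d, s)\<in>?M. Poly_Mapping.single (s + shift d) (Poly_Mapping.lookup (f d) s)) =
      (\<Sum>d\<in>apery. \<Sum>s\<in>Poly_Mapping.keys (f d). Poly_Mapping.single (s + shift d) (Poly_Mapping.lookup (f d) s))"
    using finite_apery by (simp add: sum.Sigma)
  also have "\<dots> = 0" using zero by (simp add: fd)
  finally have sum: "(\<Sum>y\<in>?M. Poly_Mapping.single (snd y + shift (fst y)) (Poly_Mapping.lookup (f (fst y)) (snd y))) = 0"
    by (simp add: case_prod_beta)
  have inj: "inj_on (\<lambda>y. snd y + shift (fst y)) ?M"
  proof (rule inj_onI, clarsimp)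
    fix d s d' s' assume *: "d \<in> apery" "s \<in> Poly_Mapping.keys (f d)" "d' \<in> apery"
      "s' \<in> Poly_Mapping.keys (f d')" "s + shift d = s' + shift d'"
    obtain m m' where "s = multidegree a' m" "s' = multidegree a' m'" using keys * by metis
    with * show "d = d' \<and> s = s'" using unique_representation by metis
  qed
  have "Poly_Mapping.lookup (f d) s = 0" if "s \<in> Poly_Mapping.keys (f d)" for s
    using sum_single_inj_zero[OF _ inj sum, of "(d, s)"] finite_apery d that by auto
  then show ?thesis by (metis in_keys_iff poly_mapping_eqI lookup_zero)
qed

lemma free_extension: "free_extension kA kC apery (\<lambda>d. Poly_Mapping.single (shift d) 1)"
proof (intro free_extension.intro free_extension_axioms.intro)
  have "0 \<in> semigroupB" unfolding semigroupB_def by (rule range_eqI[of _ _ 0]) (simp add: degB_def)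
  then show "apery \<noteq> {}" using apery_decomposition by blast
  show "Poly_Mapping.single (shift d) 1 \<in> kC" if "d \<in> apery" for d
    using that by (intro shift_mem) (simp add: apery_def)
qed (fact comm_subring_monoid_algebra noetherian_monoid_algebra finite_apery spanning independent
    kA_subset)+

text \<open>The w-th power has degree k_2 w u_j v = k_1 u_j \<gamma>, which is the degree of x^(u_j
  \<alpha>) for \<open>a'\<close>. Some \<alpha>_p is nonzero and u_j > 0, so a generator can be
  split off.\<close>

lemma generator_power_mem: "\<exists>n. t_power (c (Inr j)) ^ n \<in> gen kC (generators K a')"
proof -
  interpret C: comm_subring kC by (rule comm_subring_monoid_algebra)
  obtain p where p: "\<alpha> $ p \<noteq> 0" using alpha_nonzero by blast
  define l where "l = monomial (\<lambda>p. p) (\<lambda>p. u j * \<alpha> $ p)"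
  have l: "Poly_Mapping.lookup l p = u j * \<alpha> $ p" for p
    using lookup_monomial[of "\<lambda>p. p"] by (simp add: l_def)
  define l' where "l' = l - Poly_Mapping.single p 1"
  have "l = l' + Poly_Mapping.single p 1"
    using p u_pos[of j] by (intro poly_mapping_eqI) (auto simp: l'_def lookup_add lookup_minus lookup_single when_def l)
  then have l': "Poly_Mapping.single (multidegree a' l) 1 =
      Poly_Mapping.single (multidegree a' l') 1 * t_power (a' p)"
    by (simp add: t_power_eq mult_single flip: multidegree_add)
  have "(\<Sum>_<w. multidegree c (Poly_Mapping.single (Inr j) 1)) = multidegree a' l"
  proof (rule poly_mapping_eqI)
    fix i
    have "(\<Sum>p\<in>UNIV. Poly_Mapping.lookup l p * a p $ i) = u j * \<gamma> i"
      by (simp add: l \<gamma>_def sum_distrib_left mult.assoc)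
    then show "Poly_Mapping.lookup (\<Sum>_<w. multidegree c (Poly_Mapping.single (Inr j) 1)) i =
        Poly_Mapping.lookup (multidegree a' l) i"
      using binomial_relation[of i] lookup_multidegree_single[of c "Inr j" 1 i]
      by (simp add: lookup_sum multidegree_a' c_def glued_family_def line algebra_simps)
  qed
  then have "t_power (c (Inr j)) ^ w = Poly_Mapping.single (multidegree a' l') 1 * t_power (a' p)"
    by (simp only: t_power_eq single_power l'[unfolded t_power_eq])
  also have "\<dots> \<in> gen kC (generators K a')"
    using subsetD[OF kA_subset single_multidegree_mem]
    by (intro submod_mult[OF submod_gen] gen_base) (auto simp: generators_def)
  finally show ?thesis by blast
qed

lemma generators_c: "generators K c = generators K a' \<union> range (\<lambda>j. t_power (c (Inr j)))"
proof -
  have "c (Inl i) = a' i" for i by (simp add: c_def a'_def glued_family_def)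
  then show ?thesis by (auto simp: generators_def UNIV_sum image_Un image_image)
qed

text \<open>Multiplication by k_1 > 0 is injective on degrees, so both degree maps have the same
  fibres, and the kernel of \<open>push\<close> depends only on the fibres.\<close>

lemma toric_ideal_scale: "(toric_ideal a :: ('p, 'k) mpoly set) = toric_ideal a'"
proof -
  have iff: "multidegree a m = multidegree a m' \<longleftrightarrow> multidegree a' m = multidegree a' m'" for m m'
  proof -
    have "Poly_Mapping.lookup (multidegree a' m) i = k1 * Poly_Mapping.lookup (multidegree a m) i" for m i
      by (simp only: multidegree_a' lookup_multidegree[of a])
    then show ?thesis using k_pos by (simp add: poly_mapping_eq_iff fun_eq_iff)
  qed
  have "push (multidegree a) f = 0 \<longleftrightarrow> push (multidegree a') f = 0" for f :: "('p, 'k) mpoly"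
    by (rule iffI; erule push_eq_0_factor[rotated]) (simp_all only: iff)
  then show ?thesis unfolding toric_ideal_eq by simp
qed

lemma semigroup_ring_scale:
  "semigroup_ring K a = semigroup_ring K a'"
  "homogeneous_maximal_ideal K a = homogeneous_maximal_ideal K a'"
  by (simp_all add: semigroup_ring_def homogeneous_maximal_ideal_def toric_ideal_scale)

lemma c_nonzero: "c x \<noteq> 0" and a'_nonzero: "a' p \<noteq> 0"
  using a_nonzero b_nonzero k_pos
  by (auto simp: c_def a'_def glued_family_def vec_eq_iff split: sum.split)

theorem krull_dim_gluing: "krull_dim (semigroup_ring K a) = krull_dim (semigroup_ring K c)"
  unfolding semigroup_ring_scale krull_dim_semigroup_ring
  by (rule free_extension.chain_dim_extension[OF free_extension])

theorem depth_gluing: "depth (semigroup_ring K a) (homogeneous_maximal_ideal K a) =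
    depth (semigroup_ring K c) (homogeneous_maximal_ideal K c)"
  unfolding semigroup_ring_scale depth_semigroup_ring[OF a'_nonzero] depth_semigroup_ring[OF c_nonzero]
    generators_c
proof (rule free_extension.seq_depth_extension[OF free_extension generators_subset])
  show "range (\<lambda>j. t_power (c (Inr j))) \<subseteq> kC"
    using generators_subset[of K c] by (auto simp: generators_c)
qed (use generator_power_mem in auto)

end

theorem corollary4p5:
  fixes a :: "'p::finite \<Rightarrow> nat ^ 'n::finite"
    and b :: "'q::finite \<Rightarrow> nat ^ 'n"
    and k1 k2 :: nat
  defines "K \<equiv> TYPE('k::field)"
  defines "c \<equiv> glued_family k1 k2 a b"
  assumes a_nonzero: "\<And>i. a i \<noteq> 0"
    and b_nonzero: "\<And>j. b j \<noteq> 0"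
    and line: "on_a_line b"
    and glueable: "can_be_glued K a b"
    and gluing: "is_gluing K k1 k2 a b"
  shows "krull_dim (semigroup_ring K a) = krull_dim (semigroup_ring K c) \<and>
    depth (semigroup_ring K a) (homogeneous_maximal_ideal K a) =
      depth (semigroup_ring K c) (homogeneous_maximal_ideal K c) \<and>
    (cohen_macaulay (semigroup_ring K c) (homogeneous_maximal_ideal K c) \<longleftrightarrow>
      cohen_macaulay (semigroup_ring K a) (homogeneous_maximal_ideal K a))"
proof -
  obtain v u where "\<forall>j. b j = u j *s v" using line by (auto simp: on_a_line_def)
  moreover obtain \<alpha> \<beta> where "0 < k1" "0 < k2" "gluing_binomial \<alpha> \<beta> \<noteq> (0 :: ('p + 'q, 'k) mpoly)"
    "toric_ideal (glued_family k1 k2 a b) =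
          Idl\<^bsub>ring_on UNIV\<^esub> (mpoly_subst (\<lambda>i. Var (Inl i)) ` (toric_ideal a :: ('p, 'k) mpoly set)) <+>\<^bsub>ring_on UNIV\<^esub>
          Idl\<^bsub>ring_on UNIV\<^esub> (mpoly_subst (\<lambda>j. Var (Inr j)) ` (toric_ideal b :: ('q, 'k) mpoly set)) <+>\<^bsub>ring_on UNIV\<^esub>
          Idl\<^bsub>ring_on UNIV\<^esub> {gluing_binomial \<alpha> \<beta> :: ('p + 'q, 'k) mpoly}"
    using gluing unfolding is_gluing_def Let_def ring_of_type_algebra_eq by blast
  ultimately interpret gluing_on_line K a b k1 k2 \<alpha> \<beta> u v
    using a_nonzero b_nonzero by unfold_locales auto
  have "krull_dim (semigroup_ring K a) = krull_dim (semigroup_ring K c)"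
    "depth (semigroup_ring K a) (homogeneous_maximal_ideal K a) =
      depth (semigroup_ring K c) (homogeneous_maximal_ideal K c)"
    using krull_dim_gluing depth_gluing by (simp_all only: c_def assms(2))
  then show ?thesis by (simp add: cohen_macaulay_def)
qed

end
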